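(* Let $\{S_e : e\in\mathcal{E}\}$ be a strongly connected graph directed iterated function system (GD-IFS) in $\mathbb{R}^d$ with attractor $(K_1,\ldots,K_q)$, such that at least one $K_i$ contains at least two points, and let $j\in\mathcal{V}=\{1,\dots,q\}$. Then for every $\varepsilon>0$ and every $O\in\overline{\mathcal{T}_{j,G}}$ there exist $r\in(0,1)$ and a self-similar iterated function system (SS-IFS) $\{S_i\}_{i=1}^m$, $S_i(x)=r_iT_i(x)+v_i$, in $\mathbb{R}^d$ that satisfies the strong separation condition, with attractor $K$, such that $K\subseteq K_j$, $\dim_H K_j-\varepsilon<\dim_H K$, and $\|T_i-O\|<\varepsilon$ and $r_i=r$ for every $i\in\{1,\dots,m\}$.
   Context: Self-similar systems. An SS-IFS in $\mathbb{R}^d$ is a finite collection $\{S_i\}_{i=1}^m$ of contracting similarities of $\mathbb{R}^d$; write $S_i(x)=r_iT_i(x)+v_i$ with $0<r_i<1$, $T_i\in\mathbb{O}_d$ (the orthogonal group), $v_i\in\mathbb{R}^d$. Its attractor is the unique nonempty compact $K$ with $K=\bigcup_{i=1}^m S_i(K)$. The strong separation condition (SSC) means that the sets $S_1(K),\dots,S_m(K)$ are pairwise disjoint. Graph directed systems. Let $G(\mathcal{V},\mathcal{E})$ be a directed graph with vertex set $\mathcal{V}=\{1,\ldots,q\}$ and finite set $\mathcal{E}$ of directed edges (several edges between two vertices and loops are allowed) such that at least one edge starts from each vertex. $\mathcal{E}_{i,j}$ is the set of edges from $i$ to $j$, and $\mathcal{E}_{i,j}^k$ is the set of sequences $(e_1,\ldots,e_k)$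 of $k$ edges forming a directed path from $i$ to $j$. A GD-IFS in $\mathbb{R}^d$ is a collection $\{S_e:e\in\mathcal{E}\}$ of contracting similarities of $\mathbb{R}^d$; write $S_e(x)=r_eT_e(x)+v_e$ with $0<r_e<1$, $T_e\in\mathbb{O}_d$, $v_e\in\mathbb{R}^d$. Its attractor is the unique $q$-tuple $(K_1,\ldots,K_q)$ of nonempty compact sets with $K_i=\bigcup_{j=1}^q\bigcup_{e\in\mathcal{E}_{i,j}}S_e(K_j)$ for all $i$. It is strongly connected if for every pair of vertices $i,j$ there is a directed path from $i$ to $j$ and one from $j$ to $i$. $\mathcal{C}_j=\bigcup_{k\ge1}\mathcal{E}_{j,j}^k$ is the set of directed cycles starting and ending at $j$, and $\mathcal{T}_{j,G}$, the $j$-th transformation group, is the group generated by $\{T_{e_1}\circ\cdots\circ T_{e_k}:(e_1,\ldots,e_k)\in\mathcal{C}_j\}$. $\dim_H$ is Hausdorff dimension, $\overline{\mathcal{T}_{j,G}}$ is the closure of $\mathcal{T}_{j,G}$ in $\mathbb{O}_d$ with its usual topology, and $\|\cdot\|$ is the Euclidean operator norm. *)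

theory Defs
  imports
    "HOL-Analysis.Analysis"
    "HOL-Algebra.Generated_Groups"
    "Graph_Theory.Digraph_Component"
    "Graph_Theory.Arc_Walk"
begin

section \<open>Hausdorff dimension\<close>

text \<open>
  The term contributed by one covering set to the \<open>s\<close>-dimensional Hausdorff measure.
  The case \<open>s = 0\<close> is separate because \<open>0 powr 0 = 0\<close>, whereas \<open>diam(U)\<^sup>0 = 1\<close> is wanted
  for every nonempty \<open>U\<close>, singletons included.
\<close>
definition hausdorff_gauge :: "real \<Rightarrow> 'a::metric_space set \<Rightarrow> ennreal" where
  "hausdorff_gauge s U =
     (if U = {} then 0 else if s = 0 then 1 else ennreal (diameter U powr s))"

text \<open>
  Boundedness is required explicitly because \<^const>\<open>diameter\<close> is unspecified on unbounded sets.
  Sequences of sets cover finite covers as well, since \<open>U n = {}\<close> is allowed.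
\<close>
definition hausdorff_premeasure :: "real \<Rightarrow> real \<Rightarrow> 'a::metric_space set \<Rightarrow> ennreal" where
  "hausdorff_premeasure \<delta> s A =
     Inf {\<Sum>n. hausdorff_gauge s (U n) | U :: nat \<Rightarrow> 'a set.
            A \<subseteq> (\<Union>n. U n) \<and> (\<forall>n. bounded (U n) \<and> diameter (U n) \<le> \<delta>)}"

definition hausdorff_measure :: "real \<Rightarrow> 'a::metric_space set \<Rightarrow> ennreal" where
  "hausdorff_measure s A = (SUP \<delta>\<in>{0<..}. hausdorff_premeasure \<delta> s A)"

text \<open>Extended-real valued, so that the infimum of the empty set is \<open>\<infinity>\<close>.\<close>
definition hausdorff_dim :: "'a::metric_space set \<Rightarrow> ereal" where
  "hausdorff_dim A = Inf (ereal ` {s. 0 \<le> s \<and> hausdorff_measure s A = 0})"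


section \<open>Contracting similarities and the orthogonal group\<close>

definition similarity_map ::
    "real \<Rightarrow> real^'d^'d \<Rightarrow> real^'d \<Rightarrow> real^'d \<Rightarrow> real^'d" where
  "similarity_map r T v x = r *\<^sub>R (T *v x) + v"

definition contracting_similarity :: "real \<Rightarrow> real^'d^'d \<Rightarrow> bool" where
  "contracting_similarity r T \<longleftrightarrow> 0 < r \<and> r < 1 \<and> orthogonal_matrix T"

definition orthogonal_group :: "(real^'d^'d) monoid" where
  "orthogonal_group = \<lparr>carrier = {A. orthogonal_matrix A}, mult = (**), one = mat 1\<rparr>"

lemma group_orthogonal_group: "group (orthogonal_group :: (real^'d^'d) monoid)"
proof (rule groupI)
  fix A :: "real^'d^'d"
  assume "A \<in> carrier orthogonal_group"
  then have A: "orthogonal_matrix A"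
    by (simp add: orthogonal_group_def)
  then have "orthogonal_matrix (transpose A)" "transpose A ** A = mat 1"
    by (simp_all add: orthogonal_matrix_def)
  then show "\<exists>B\<in>carrier orthogonal_group. B \<otimes>\<^bsub>orthogonal_group\<^esub> A = \<one>\<^bsub>orthogonal_group\<^esub>"
    by (auto simp: orthogonal_group_def intro!: exI[of _ "transpose A"])
qed (auto simp: orthogonal_group_def orthogonal_matrix_mul orthogonal_matrix_id
       matrix_mul_assoc)


section \<open>Self-similar iterated function systems\<close>

definition ss_ifs :: "nat \<Rightarrow> (nat \<Rightarrow> real) \<Rightarrow> (nat \<Rightarrow> real^'d^'d) \<Rightarrow> bool" where
  "ss_ifs m r T \<longleftrightarrow> 1 \<le> m \<and> (\<forall>i\<in>{1..m}. contracting_similarity (r i) (T i))"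

definition ss_attractor ::
    "nat \<Rightarrow> (nat \<Rightarrow> real) \<Rightarrow> (nat \<Rightarrow> real^'d^'d) \<Rightarrow> (nat \<Rightarrow> real^'d) \<Rightarrow> (real^'d) set \<Rightarrow> bool" where
  "ss_attractor m r T v K \<longleftrightarrow>
     K \<noteq> {} \<and> compact K \<and> K = (\<Union>i\<in>{1..m}. similarity_map (r i) (T i) (v i) ` K)"

text \<open>The last argument is meant to be the attractor of the system.\<close>
definition strong_separation ::
    "nat \<Rightarrow> (nat \<Rightarrow> real) \<Rightarrow> (nat \<Rightarrow> real^'d^'d) \<Rightarrow> (nat \<Rightarrow> real^'d) \<Rightarrow> (real^'d) set \<Rightarrow> bool" where
  "strong_separation m r T v K \<longleftrightarrow>
     disjoint_family_on (\<lambda>i. similarity_map (r i) (T i) (v i) ` K) {1..m}"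


section \<open>Graph directed iterated function systems\<close>

text \<open>The edge \<open>e\<close> goes from \<open>tail G e\<close> to \<open>head G e\<close>.\<close>

definition edges_between :: "('v, 'e) pre_digraph \<Rightarrow> 'v \<Rightarrow> 'v \<Rightarrow> 'e set" where
  "edges_between G i j = {e \<in> arcs G. tail G e = i \<and> head G e = j}"

definition gd_ifs ::
    "('v, 'e) pre_digraph \<Rightarrow> ('e \<Rightarrow> real) \<Rightarrow> ('e \<Rightarrow> real^'d^'d) \<Rightarrow> bool" where
  "gd_ifs G r T \<longleftrightarrow>
     fin_digraph G \<and>
     (\<forall>i\<in>verts G. \<exists>e\<in>arcs G. tail G e = i) \<and>
     (\<forall>e\<in>arcs G. contracting_similarity (r e) (T e))"

definition gd_attractor ::
    "('v, 'e) pre_digraph \<Rightarrow> ('e \<Rightarrow> real) \<Rightarrow> ('e \<Rightarrow> real^'d^'d) \<Rightarrow> ('e \<Rightarrow> real^'d) \<Rightarrow>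
     ('v \<Rightarrow> (real^'d) set) \<Rightarrow> bool" where
  "gd_attractor G r T v K \<longleftrightarrow>
     (\<forall>i\<in>verts G. K i \<noteq> {} \<and> compact (K i) \<and>
        K i = (\<Union>j\<in>verts G. \<Union>e\<in>edges_between G i j. similarity_map (r e) (T e) (v e) ` K j))"

text \<open>Closed directed walks of length at least one; edges and vertices may repeat.\<close>
definition directed_cycles :: "('v, 'e) pre_digraph \<Rightarrow> 'v \<Rightarrow> 'e list set" where
  "directed_cycles G j = {p. p \<noteq> [] \<and> pre_digraph.awalk G j p j}"

text \<open>The matrix of \<open>T e\<^sub>1 \<circ> \<dots> \<circ> T e\<^sub>k\<close> for \<open>p = [e\<^sub>1, \<dots>, e\<^sub>k]\<close>.\<close>
definition walk_matrix :: "('e \<Rightarrow> real^'d^'d) \<Rightarrow> 'e list \<Rightarrow> real^'d^'d" where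
  "walk_matrix T p = foldr (\<lambda>e A. T e ** A) p (mat 1)"

definition transformation_group ::
    "('v, 'e) pre_digraph \<Rightarrow> ('e \<Rightarrow> real^'d^'d) \<Rightarrow> 'v \<Rightarrow> (real^'d^'d) set" where
  "transformation_group G T j =
     generate orthogonal_group (walk_matrix T ` directed_cycles G j)"

end

theory Submission
  imports Defs "HOL-Real_Asymp.Real_Asymp"
begin

text \<open>
  The self-similar system is made of maps along directed cycles at \<open>j\<close>. Such a map sends \<open>K j\<close>
  into itself, so a finite family \<open>F\<close> of cycles with pairwise disjoint images of \<open>K j\<close> has its
  attractor inside \<open>K j\<close> and satisfies the strong separation condition. If moreover all cycles in
  \<open>F\<close> have the same ratio \<open>\<rho>\<close> and \<open>card F * \<rho> powr t \<ge> 1\<close>, then the attractor has dimension at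
  least \<open>t\<close> (\<open>limit_set_dim_ge\<close>). It remains to find, for \<open>t\<close> close to \<open>dim K j\<close>, enough disjoint
  cycles with one ratio and with matrices near \<open>Q\<close>.

  Orientation. The matrices of the cycles at \<open>j\<close> form a semigroup of orthogonal matrices. In a
  compact group, inverses are limits of positive powers, hence this semigroup is dense in the group
  it generates. So every cycle can be prolonged by another one such that the product of the matrices
  is near \<open>Q\<close>, and by compactness finitely many prolongations suffice for all cycles
  (\<open>finite_steering_set\<close>). Hence there is a finite set \<open>Z\<close> of walks such that each walk from \<open>j\<close>
  becomes a cycle with matrix near \<open>Q\<close> after appending some member of \<open>Z\<close> (\<open>steering_walks\<close>).

  Counting. Let \<open>t < t' < dim K j\<close>. Positivity of the \<open>t'\<close>-dimensional Hausdorff measure bounds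
  \<open>\<Sum>d powr t'\<close> away from \<open>0\<close> for all fine finite covers by sets of diameters at most \<open>d\<close>. The
  cylinders of the walks of a fixed length \<open>n\<close> from \<open>j\<close> cover \<open>K j\<close>. Label each walk by its ratio and
  by the member of \<open>Z\<close> chosen for it, and select a maximal set of walks in which cylinders of equal
  label are disjoint. By maximality the slightly enlarged selected cylinders still cover \<open>K j\<close>. The
  ratio of a walk depends only on how often each edge occurs, so the number of labels grows only
  polynomially in \<open>n\<close>, while passing from the exponent \<open>t'\<close> to \<open>t\<close> gains an exponential factor.
  Hence, for large \<open>n\<close>, the selected walks of a single label give \<open>card F * \<rho> powr t\<close> as large as
  desired (\<open>homogeneous_packing\<close>), in particular large enough to absorb the ratio of the common
  prolongation. If \<open>dim K j = 0\<close>, a single cycle is enough.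
\<close>

section \<open>Lower bounds for Hausdorff dimension from finite covers\<close>

lemma hausdorff_gauge_pos:
  "0 < s \<Longrightarrow> hausdorff_gauge s U = ennreal (diameter U powr s)"
  by (auto simp: hausdorff_gauge_def)

text \<open>
  Below the dimension, the Hausdorff measure is positive, hence so is the premeasure at some scale.
  The finite form with numbers \<open>d j\<close> instead of diameters is all that the counting argument needs.
\<close>
lemma dim_gt_imp_finite_cover_sum_ge:
  fixes X :: "'a::metric_space set" and t :: real
  assumes t: "0 < t" "ereal t < hausdorff_dim X"
  shows "\<exists>c>0. \<exists>\<delta>>0. \<forall>(J :: 'i set) U d. finite J \<longrightarrow> X \<subseteq> (\<Union>j\<in>J. U j) \<longrightarrow>
       (\<forall>j\<in>J. \<forall>x\<in>U j. \<forall>y\<in>U j. dist x y \<le> d j) \<longrightarrow> (\<forall>j\<in>J. 0 \<le> d j \<and> d j \<le> \<delta>) \<longrightarrow>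
       c \<le> (\<Sum>j\<in>J. d j powr t)"
proof -
  have "hausdorff_measure t X \<noteq> 0"
  proof
    assume "hausdorff_measure t X = 0"
    then have "hausdorff_dim X \<le> ereal t"
      unfolding hausdorff_dim_def using t by (intro Inf_lower) auto
    then show False using t by simp
  qed
  then obtain \<delta> where \<delta>: "0 < \<delta>" "hausdorff_premeasure \<delta> t X \<noteq> 0"
    unfolding hausdorff_measure_def
    by (metis (no_types, lifting) SUP_least greaterThan_iff le_zero_eq order_refl)
  obtain c where c: "0 < c" "ennreal c \<le> hausdorff_premeasure \<delta> t X"
  proof (cases "hausdorff_premeasure \<delta> t X")
    case (real a)
    then show ?thesis using \<delta> that[of a] by (auto simp: order_less_le)
  next
    case top
    then show ?thesis using that[of 1] by simp
  qed
  show ?thesis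
  proof (rule exI[of _ c], intro exI[of _ \<delta>] conjI c(1) \<delta>(1) allI impI)
    fix J :: "'i set" and U :: "'i \<Rightarrow> 'a set" and d :: "'i \<Rightarrow> real"
    assume J: "finite J" and cov: "X \<subseteq> (\<Union>j\<in>J. U j)"
      and d: "\<forall>j\<in>J. \<forall>x\<in>U j. \<forall>y\<in>U j. dist x y \<le> d j"
      and d\<delta>: "\<forall>j\<in>J. 0 \<le> d j \<and> d j \<le> \<delta>"
    have bdd: "bounded (U j)" if "j \<in> J" for j
      using d that by (meson bounded_two_points)
    have diam: "diameter (U j) \<le> d j" if "j \<in> J" for j
    proof (cases "U j = {}")
      case False
      then have "(SUP (x,y)\<in>U j \<times> U j. dist x y) \<le> d j"
        using d that by (intro cSUP_least) auto
      with False show ?thesis by (simp add: diameter_def)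
    qed (use d\<delta> that in auto)
    obtain h where h: "bij_betw h {..<card J} J"
      using J by (metis atLeast0LessThan ex_bij_betw_nat_finite)
    define V where "V n = (if n < card J then U (h n) else {})" for n
    have hJ: "h n \<in> J" if "n < card J" for n
      using h that by (auto simp: bij_betw_def)
    have "X \<subseteq> (\<Union>n. V n)"
    proof
      fix x assume "x \<in> X"
      then obtain j where "j \<in> J" "x \<in> U j" using cov by auto
      then have "j \<in> h ` {..<card J}" using h by (simp add: bij_betw_def)
      then obtain n where "n < card J" "h n = j" by auto
      then show "x \<in> (\<Union>n. V n)" using \<open>x \<in> U j\<close> by (intro UN_I[of n]) (simp_all add: V_def)
    qed
    moreover have "bounded (V n) \<and> diameter (V n) \<le> \<delta>" for n
    proof (cases "n < card J")
      case True
      then have "diameter (U (h n)) \<le> \<delta>" using diam[OF hJ] d\<delta> hJ by (meson order_trans)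
      then show ?thesis using bdd[OF hJ[OF True]] True by (simp add: V_def)
    qed (use \<delta> in \<open>simp add: V_def\<close>)
    ultimately have "hausdorff_premeasure \<delta> t X \<le> (\<Sum>n. hausdorff_gauge t (V n))"
      unfolding hausdorff_premeasure_def by (intro Inf_lower) blast
    also have "\<dots> = (\<Sum>n\<in>{..<card J}. hausdorff_gauge t (V n))"
      by (rule suminf_finite) (auto simp: V_def hausdorff_gauge_def)
    also have "\<dots> = (\<Sum>n\<in>{..<card J}. ennreal (diameter (U (h n)) powr t))"
      using t by (intro sum.cong) (auto simp: V_def hausdorff_gauge_pos)
    also have "\<dots> \<le> (\<Sum>n\<in>{..<card J}. ennreal (d (h n) powr t))"
      using t diam[OF hJ] bdd[OF hJ]
      by (intro sum_mono ennreal_leI powr_mono2) (auto simp: diameter_ge_0)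
    also have "\<dots> = ennreal (\<Sum>n\<in>{..<card J}. d (h n) powr t)"
      by (intro sum_ennreal) auto
    also have "(\<Sum>n\<in>{..<card J}. d (h n) powr t) = (\<Sum>j\<in>J. d j powr t)"
      by (rule sum.reindex_bij_betw[OF h])
    finally show "c \<le> (\<Sum>j\<in>J. d j powr t)" using c
      by (subst ennreal_le_iff[symmetric]) (auto intro: sum_nonneg order_trans)
  qed
qed

section \<open>Self-similar systems with one common ratio and disjoint images\<close>

locale separated_homogeneous_ifs =
  fixes I :: "'i set" and f :: "'i \<Rightarrow> 'a::heine_borel \<Rightarrow> 'a" and \<rho> :: real and X :: "'a set"
  assumes I: "finite I" "I \<noteq> {}"
    and ratio: "0 < \<rho>" "\<rho> < 1"
    and X: "compact X" "X \<noteq> {}"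
    and sim: "i \<in> I \<Longrightarrow> dist (f i x) (f i y) = \<rho> * dist x y"
    and into: "i \<in> I \<Longrightarrow> f i ` X \<subseteq> X"
    and disj: "disjoint_family_on (\<lambda>i. f i ` X) I"
begin

definition hutchinson :: "'a set \<Rightarrow> 'a set" where
  "hutchinson A = (\<Union>i\<in>I. f i ` A)"

definition limit_set :: "'a set" where
  "limit_set = (\<Inter>n. (hutchinson ^^ n) X)"

lemma cont: "i \<in> I \<Longrightarrow> continuous_on A (f i)"
  using ratio sim by (intro lipschitz_on_continuous_on[of \<rho>]) (auto simp: lipschitz_on_def)

lemma inj_map: "i \<in> I \<Longrightarrow> f i x = f i y \<longleftrightarrow> x = y"
  using sim[of i x y] ratio by auto

lemma hutchinson_mono: "A \<subseteq> B \<Longrightarrow> hutchinson A \<subseteq> hutchinson B"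
  by (auto simp: hutchinson_def)

lemma iter_compact: "compact ((hutchinson ^^ n) X)"
  using X I by (induction n) (auto simp: hutchinson_def intro!: compact_UN compact_continuous_image cont)

lemma iter_nonempty: "(hutchinson ^^ n) X \<noteq> {}"
  using X I by (induction n) (auto simp: hutchinson_def)

lemma iter_Suc: "(hutchinson ^^ Suc n) X \<subseteq> (hutchinson ^^ n) X"
proof (induction n)
  case 0
  then show ?case using into by (auto simp: hutchinson_def)
next
  case (Suc n)
  then show ?case using hutchinson_mono[OF Suc] by simp
qed

lemma iter_antimono: "m \<le> n \<Longrightarrow> (hutchinson ^^ n) X \<subseteq> (hutchinson ^^ m) X"
  by (rule lift_Suc_antimono_le[where f="\<lambda>n. (hutchinson ^^ n) X"]) (use iter_Suc in auto)

lemma limit_set_subset: "limit_set \<subseteq> X"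
  unfolding limit_set_def by (metis INT_lower UNIV_I funpow_0)

lemma limit_set_compact: "compact limit_set"
proof -
  have "closed limit_set"
    unfolding limit_set_def by (intro closed_INT ballI compact_imp_closed iter_compact)
  then show ?thesis
    using limit_set_subset X(1) by (metis compact_Int_closed inf.absorb_iff2)
qed

lemma limit_set_nonempty: "limit_set \<noteq> {}"
  unfolding limit_set_def by (intro compact_nest iter_compact iter_nonempty iter_antimono)

text \<open>
  Disjointness and injectivity let the union over the maps commute with the decreasing intersection:
  the index \<open>i\<close> of the image containing a point is the same at all stages.
\<close>
lemma limit_set_fixed: "limit_set = (\<Union>i\<in>I. f i ` limit_set)"
proof
  show "limit_set \<subseteq> (\<Union>i\<in>I. f i ` limit_set)"
  proof
    fix x assume x: "x \<in> limit_set"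
    have "x \<in> (hutchinson ^^ Suc 0) X" using x unfolding limit_set_def by blast
    then obtain i where i: "i \<in> I" "x \<in> f i ` X" by (auto simp: hutchinson_def)
    then obtain y where y: "x = f i y" "y \<in> X" by auto
    have "y \<in> (hutchinson ^^ n) X" for n
    proof -
      have "x \<in> (hutchinson ^^ Suc n) X" using x unfolding limit_set_def by blast
      then obtain i' z where z: "i' \<in> I" "x = f i' z" "z \<in> (hutchinson ^^ n) X"
        by (auto simp: hutchinson_def)
      then have "z \<in> X" using iter_antimono[of 0 n] by auto
      then have "x \<in> f i' ` X" using z by auto
      then have "i' = i" using i z disj by (auto simp: disjoint_family_on_def)
      then show ?thesis using z y i inj_map by auto
    qed
    then show "x \<in> (\<Union>i\<in>I. f i ` limit_set)" using i y by (auto simp: limit_set_def)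
  qed
  show "(\<Union>i\<in>I. f i ` limit_set) \<subseteq> limit_set"
  proof -
    have "f i x \<in> (hutchinson ^^ n) X" if "i \<in> I" "x \<in> limit_set" for i x n
    proof -
      have "f i x \<in> (hutchinson ^^ Suc n) X"
        using that by (auto simp: hutchinson_def limit_set_def)
      then show ?thesis using iter_Suc by blast
    qed
    then show ?thesis by (auto simp: limit_set_def)
  qed
qed

lemma disj_limit_set: "disjoint_family_on (\<lambda>i. f i ` limit_set) I"
  using disj limit_set_subset unfolding disjoint_family_on_def by blast

lemma gap:
  obtains \<eta> where "0 < \<eta>"
    "\<And>i k x y. i \<in> I \<Longrightarrow> k \<in> I \<Longrightarrow> i \<noteq> k \<Longrightarrow> x \<in> f i ` limit_set \<Longrightarrow> y \<in> f k ` limit_set \<Longrightarrow> \<eta> \<le> dist x y"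
proof -
  have "\<exists>e>0. \<forall>x\<in>f i ` limit_set. \<forall>y\<in>f k ` limit_set. e \<le> dist x y" if "i \<in> I" "k \<in> I" "i \<noteq> k" for i k
    using that disj_limit_set
    by (intro separate_compact_closed compact_imp_closed compact_continuous_image limit_set_compact cont)
       (auto simp: disjoint_family_on_def)
  then obtain e where e: "\<And>i k. i \<in> I \<Longrightarrow> k \<in> I \<Longrightarrow> i \<noteq> k \<Longrightarrow>
      e i k > 0 \<and> (\<forall>x\<in>f i ` limit_set. \<forall>y\<in>f k ` limit_set. e i k \<le> dist x y)"
    by metis
  define P where "P = insert 1 ((\<lambda>(i,k). e i k) ` {(i,k). i \<in> I \<and> k \<in> I \<and> i \<noteq> k})"
  have "finite {(i,k). i \<in> I \<and> k \<in> I \<and> i \<noteq> k}"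
    by (rule finite_subset[of _ "I \<times> I"]) (use I in auto)
  then have fin: "finite P" by (simp add: P_def)
  show ?thesis
  proof (rule that[of "Min P"])
    show "0 < Min P" using fin e by (auto simp: P_def)
    fix i k x y assume ik: "i \<in> I" "k \<in> I" "i \<noteq> k" "x \<in> f i ` limit_set" "y \<in> f k ` limit_set"
    have "Min P \<le> e i k" using fin ik by (intro Min_le) (auto simp: P_def)
    also have "\<dots> \<le> dist x y" using e ik by blast
    finally show "Min P \<le> dist x y" .
  qed
qed

text \<open>
  The mass distribution principle, without a measure. If some \<open>d k \<ge> \<eta>\<close>, that term alone is at
  least \<open>1\<close>. Otherwise each \<open>U j\<close> meets only one of the pieces \<open>f i ` limit_set\<close>, so the cover splits
  into disjoint covers of the pieces. Pulling one of them back by \<open>f i\<close> gives a cover of the whole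
  limit set with all diameters divided by \<open>\<rho>\<close>, and \<open>card I * \<rho> powr s \<ge> 1\<close> makes up for the
  scaling of the sums. The exponent \<open>n\<close> bounds how often this can be repeated.
\<close>
lemma finite_cover_sum_ge:
  fixes J :: "'j set" and U :: "'j \<Rightarrow> 'a set"
  assumes s: "0 < s" "1 \<le> real (card I) * \<rho> powr s" and \<eta>: "0 < \<eta>"
    and gap: "\<And>i k x y. i \<in> I \<Longrightarrow> k \<in> I \<Longrightarrow> i \<noteq> k \<Longrightarrow> x \<in> f i ` limit_set \<Longrightarrow> y \<in> f k ` limit_set \<Longrightarrow> \<eta> \<le> dist x y"
  shows "finite J \<Longrightarrow> limit_set \<subseteq> (\<Union>j\<in>J. U j) \<Longrightarrow>
    (\<And>j x y. j \<in> J \<Longrightarrow> x \<in> U j \<Longrightarrow> y \<in> U j \<Longrightarrow> dist x y \<le> d j) \<Longrightarrow>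
    (\<And>j. j \<in> J \<Longrightarrow> \<eta> * \<rho> ^ n \<le> d j) \<Longrightarrow> 1 \<le> (\<Sum>j\<in>J. (d j / \<eta>) powr s)"
proof (induction n arbitrary: J U d)
  have large: "1 \<le> (\<Sum>j\<in>J. (d j / \<eta>) powr s)" if "finite J" "k \<in> J" "\<eta> \<le> d k" for J :: "'j set" and k d
  proof -
    have "1 \<le> (d k / \<eta>) powr s" using that \<eta> s by (intro ge_one_powr_ge_zero) auto
    also have "\<dots> \<le> (\<Sum>j\<in>J. (d j / \<eta>) powr s)" using that by (intro member_le_sum) auto
    finally show ?thesis .
  qed
  {
    case 0
    then obtain k where "k \<in> J" using limit_set_nonempty by blast
    then show ?case using 0 large[of J k d] by simp
  next
    case (Suc n)
    show ?case
    proof (cases "\<exists>k\<in>J. \<eta> \<le> d k")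
      case True
      then obtain k where "k \<in> J" "\<eta> \<le> d k" by blast
      then show ?thesis using large[OF Suc.prems(1), of k d] by simp
    next
      case False
      define Ji where "Ji i = {j\<in>J. U j \<inter> f i ` limit_set \<noteq> {}}" for i
      have fin: "finite (Ji i)" for i using Suc.prems(1) by (simp add: Ji_def)
      have dis: "Ji i \<inter> Ji k = {}" if "i \<in> I" "k \<in> I" "i \<noteq> k" for i k
        using gap[OF that] Suc.prems(3) False by (fastforce simp: Ji_def)
      have "\<rho> powr s \<le> (\<Sum>j\<in>Ji i. (d j / \<eta>) powr s)" if i: "i \<in> I" for i
      proof -
        have "1 \<le> (\<Sum>j\<in>Ji i. ((d j / \<rho>) / \<eta>) powr s)"
        proof (rule Suc.IH[where U="\<lambda>j. f i -` U j"])
          show "limit_set \<subseteq> (\<Union>j\<in>Ji i. f i -` U j)"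
          proof
            fix x assume x: "x \<in> limit_set"
            then have "f i x \<in> limit_set" using limit_set_fixed i by blast
            then obtain j where "j \<in> J" "f i x \<in> U j" using Suc.prems(2) by blast
            then show "x \<in> (\<Union>j\<in>Ji i. f i -` U j)" using x by (auto simp: Ji_def)
          qed
          show "dist x y \<le> d j / \<rho>" if "j \<in> Ji i" "x \<in> f i -` U j" "y \<in> f i -` U j" for j x y
            using Suc.prems(3)[of j "f i x" "f i y"] that sim[OF i, of x y] ratio
            by (simp add: Ji_def field_simps)
          show "\<eta> * \<rho> ^ n \<le> d j / \<rho>" if "j \<in> Ji i" for j
            using Suc.prems(4)[of j] that ratio by (simp add: Ji_def field_simps)
        qed (rule fin)
        also have "\<dots> = (\<Sum>j\<in>Ji i. (d j / \<eta>) powr s / \<rho> powr s)"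
          by (simp add: powr_divide powr_mult mult.commute)
        also have "\<dots> = (\<Sum>j\<in>Ji i. (d j / \<eta>) powr s) / \<rho> powr s"
          by (simp add: sum_divide_distrib)
        finally show ?thesis using ratio by (simp add: field_simps)
      qed
      then have "real (card I) * \<rho> powr s \<le> (\<Sum>i\<in>I. \<Sum>j\<in>Ji i. (d j / \<eta>) powr s)"
        using sum_bounded_below[of I "\<rho> powr s" "\<lambda>i. \<Sum>j\<in>Ji i. (d j / \<eta>) powr s"] by simp
      also have "\<dots> = (\<Sum>j\<in>(\<Union>i\<in>I. Ji i). (d j / \<eta>) powr s)"
        using I fin dis by (intro sum.UNION_disjoint[symmetric]) auto
      also have "\<dots> \<le> (\<Sum>j\<in>J. (d j / \<eta>) powr s)"
        using Suc.prems(1) by (intro sum_mono2) (auto simp: Ji_def)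
      finally show ?thesis using s by simp
    qed
  }
qed

text \<open>
  A countable cover is reduced to a finite open one by compactness; the sets are first thickened
  so little that the sum grows by at most half of the bound to be proved.
\<close>
lemma premeasure_pos:
  assumes s: "0 < s" "1 \<le> real (card I) * \<rho> powr s"
  obtains c where "0 < c" "ennreal c \<le> hausdorff_premeasure \<delta> s limit_set"
proof -
  obtain \<eta> where \<eta>: "0 < \<eta>"
    "\<And>i k x y. i \<in> I \<Longrightarrow> k \<in> I \<Longrightarrow> i \<noteq> k \<Longrightarrow> x \<in> f i ` limit_set \<Longrightarrow> y \<in> f k ` limit_set \<Longrightarrow> \<eta> \<le> dist x y"
    using gap by metis
  define \<kappa> where "\<kappa> = \<eta> powr s / 2"
  have \<kappa>: "0 < \<kappa>" using \<eta> by (simp add: \<kappa>_def)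
  have "ennreal \<kappa> \<le> (\<Sum>n. hausdorff_gauge s (U n))"
    if U: "limit_set \<subseteq> (\<Union>n. U n)" "\<And>n. bounded (U n)" for U :: "nat \<Rightarrow> 'a set"
  proof -
    define a where "a n = diameter (U n)" for n
    have a0: "0 \<le> a n" for n using U by (simp add: a_def diameter_ge_0)
    have "\<exists>D. a n < D \<and> D powr s \<le> a n powr s + \<kappa> * (1/2) ^ Suc n" for n
    proof -
      have "((\<lambda>x. x powr s) \<longlongrightarrow> a n powr s) (at_right (a n))"
        using s a0[of n]
        by (intro tendsto_powr2) (auto simp: eventually_at_filter tendsto_ident_at intro!: always_eventually)
      then have "\<forall>\<^sub>F x in at_right (a n). x powr s < a n powr s + \<kappa> * (1/2) ^ Suc n"
        using \<kappa> by (intro order_tendstoD) auto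
      moreover have "\<forall>\<^sub>F x in at_right (a n). a n < x"
        by (simp add: eventually_at_right_less)
      ultimately have "\<forall>\<^sub>F x in at_right (a n). a n < x \<and> x powr s < a n powr s + \<kappa> * (1/2) ^ Suc n"
        by eventually_elim auto
      then obtain D where "a n < D \<and> D powr s < a n powr s + \<kappa> * (1/2) ^ Suc n"
        using eventually_happens'[OF trivial_limit_at_right_real] by blast
      then show ?thesis by (intro exI[of _ D]) auto
    qed
    then obtain D where D: "\<And>n. a n < D n" "\<And>n. D n powr s \<le> a n powr s + \<kappa> * (1/2) ^ Suc n"
      by metis
    have Dpos: "0 < D n" for n using D(1)[of n] a0[of n] by simp
    define V where "V n = (\<Union>x\<in>U n. ball x ((D n - a n) / 2))" for n
    have Vopen: "open (V n)" for n by (auto simp: V_def)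
    have UV: "U n \<subseteq> V n" for n using D(1)[of n] by (force simp: V_def)
    have Vdiam: "dist x y \<le> D n" if xy: "x \<in> V n" "y \<in> V n" for x y n
    proof -
      obtain x' y' where 1: "x' \<in> U n" "dist x' x < (D n - a n) / 2" "y' \<in> U n" "dist y' y < (D n - a n) / 2"
        using xy by (auto simp: V_def)
      have "dist x' y' \<le> a n"
        unfolding a_def using diameter_bounded_bound U(2) 1 by blast
      moreover have "dist x y \<le> dist x' x + dist x' y' + dist y' y"
        by (smt (verit) dist_commute dist_triangle)
      ultimately show ?thesis using 1 by (simp add: field_simps)
    qed
    have "limit_set \<subseteq> \<Union> (V ` UNIV)" using U(1) UV by blast
    then obtain J where J: "finite J" "limit_set \<subseteq> (\<Union>n\<in>J. V n)"
      using compactE_image[OF limit_set_compact, of UNIV V] Vopen by metis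
    have "J \<noteq> {}" using J limit_set_nonempty by auto
    have minpos: "0 < Min (D ` J)" using J(1) \<open>J \<noteq> {}\<close> Dpos by simp
    obtain N where N: "\<rho> ^ N < Min (D ` J) / \<eta>"
      using real_arch_pow_inv[of "Min (D ` J) / \<eta>" \<rho>] minpos \<eta> ratio by auto
    have "\<eta> * \<rho> ^ N \<le> D n" if "n \<in> J" for n
    proof -
      have "\<eta> * \<rho> ^ N \<le> Min (D ` J)" using N \<eta> by (simp add: field_simps)
      also have "\<dots> \<le> D n" using J that by simp
      finally show ?thesis .
    qed
    with J Vdiam have "1 \<le> (\<Sum>n\<in>J. (D n / \<eta>) powr s)"
      by (intro finite_cover_sum_ge[OF s \<eta>, where U=V and d=D and n=N])
    also have "\<dots> = (\<Sum>n\<in>J. D n powr s) / \<eta> powr s"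
      using Dpos \<eta> by (simp add: powr_divide sum_divide_distrib less_imp_le)
    finally have "\<eta> powr s \<le> (\<Sum>n\<in>J. D n powr s)" using \<eta> by (simp add: field_simps)
    also have "\<dots> \<le> (\<Sum>n\<in>J. a n powr s) + (\<Sum>n\<in>J. \<kappa> * (1/2) ^ Suc n)"
      using D(2) by (simp add: sum.distrib[symmetric] sum_mono)
    also have "(\<Sum>n\<in>J. \<kappa> * (1/2) ^ Suc n) \<le> \<kappa>"
    proof -
      have *: "(\<lambda>n. \<kappa> * (1/2) ^ Suc n) sums (\<kappa> * 1)"
        by (intro sums_mult power_half_series)
      show ?thesis
        using sum_le_suminf[OF sums_summable[OF *] J(1)] sums_unique[OF *] \<kappa> by auto
    qed
    finally have "\<kappa> \<le> (\<Sum>n\<in>J. a n powr s)" by (simp add: \<kappa>_def)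
    then have "ennreal \<kappa> \<le> ennreal (\<Sum>n\<in>J. a n powr s)" by (rule ennreal_leI)
    also have "\<dots> = (\<Sum>n\<in>J. hausdorff_gauge s (U n))"
      using s by (simp add: hausdorff_gauge_pos a_def)
    also have "\<dots> \<le> (\<Sum>n. hausdorff_gauge s (U n))"
      using J(1) by (intro sum_le_suminf) auto
    finally show ?thesis .
  qed
  then have "ennreal \<kappa> \<le> hausdorff_premeasure \<delta> s limit_set"
    unfolding hausdorff_premeasure_def by (intro Inf_greatest) blast
  then show ?thesis using that \<kappa> by blast
qed

lemma premeasure_zero_ge_1: "1 \<le> hausdorff_premeasure \<delta> 0 limit_set"
  unfolding hausdorff_premeasure_def
proof (intro Inf_greatest, clarify)
  fix U :: "nat \<Rightarrow> 'a set" assume "limit_set \<subseteq> (\<Union>n. U n)"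
  then obtain n where "U n \<noteq> {}" using limit_set_nonempty by blast
  then have "1 = hausdorff_gauge 0 (U n)" by (simp add: hausdorff_gauge_def)
  also have "\<dots> \<le> (\<Sum>n. hausdorff_gauge 0 (U n))"
    using sum_le_suminf[of "\<lambda>n. hausdorff_gauge 0 (U n)" "{n}"] by simp
  finally show "1 \<le> (\<Sum>n. hausdorff_gauge 0 (U n))" .
qed

text \<open>
  The lower half of the Moran-Hutchinson formula. Every exponent \<open>s < t\<close> also satisfies
  \<open>card I * \<rho> powr s \<ge> 1\<close>, so its premeasures are positive.
\<close>
lemma limit_set_dim_ge:
  assumes t: "1 \<le> real (card I) * \<rho> powr t"
  shows "ereal t \<le> hausdorff_dim limit_set"
  unfolding hausdorff_dim_def
proof (intro Inf_greatest, clarify)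
  fix s :: real assume s: "0 \<le> s" "hausdorff_measure s limit_set = 0"
  have zero: "hausdorff_premeasure 1 s limit_set \<le> 0"
    using s(2) SUP_upper[of 1 "{0<..}" "\<lambda>\<delta>. hausdorff_premeasure \<delta> s limit_set"]
    by (simp add: hausdorff_measure_def)
  show "ereal t \<le> ereal s"
  proof (rule ccontr)
    assume "\<not> ereal t \<le> ereal s"
    then have "\<rho> powr t \<le> \<rho> powr s" using ratio by (intro powr_mono') auto
    then have 1: "1 \<le> real (card I) * \<rho> powr s"
      using t by (meson mult_left_mono of_nat_0_le_iff order_trans)
    show False
    proof (cases "s = 0")
      case True
      then show False using zero premeasure_zero_ge_1[of 1] by (simp add: not_one_le_zero)
    next
      case False
      then obtain c where "0 < c" "ennreal c \<le> hausdorff_premeasure 1 s limit_set"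
        using premeasure_pos[of s 1] s 1 by auto
      then show False using zero by auto
    qed
  qed
qed

end

lemma hausdorff_dim_nonneg: "0 \<le> hausdorff_dim X"
  unfolding hausdorff_dim_def by (intro Inf_greatest) auto


section \<open>Semigroups of orthogonal matrices\<close>

lemma norm_matrix_vector_mult_le:
  fixes M :: "real^'n^'m"
  shows "norm (M *v x) \<le> norm M * norm x"
proof -
  have "norm (M *v x) = L2_set (\<lambda>i. norm (M $ i \<bullet> x)) UNIV"
    by (simp add: norm_vec_def matrix_vector_mul_component)
  also have "\<dots> \<le> L2_set (\<lambda>i. norm (M $ i) * norm x) UNIV"
    by (intro L2_set_mono) (auto simp: Cauchy_Schwarz_ineq2)
  also have "\<dots> = norm M * norm x"
    by (subst norm_vec_def[of M]) (simp add: L2_set_left_distrib)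
  finally show ?thesis .
qed

lemma onorm_le_norm_matrix: "onorm ((*v) (M :: real^'n^'m)) \<le> norm M"
  by (intro onorm_le norm_matrix_vector_mult_le)

lemma norm_orthogonal_mult_vector:
  fixes B :: "real^'n^'n"
  assumes "orthogonal_matrix B"
  shows "norm (B *v x) = norm x"
  using assms
  by (intro orthogonal_transformation_norm) (simp add: orthogonal_transformation_matrix)

lemma norm_orthogonal_mult_right:
  fixes M B :: "real^'n^'n"
  assumes "orthogonal_matrix B"
  shows "norm (M ** B) = norm M"
proof -
  have "orthogonal_matrix (transpose B)" using assms by simp
  then have *: "norm (transpose B *v x) = norm x" for x
    by (rule norm_orthogonal_mult_vector)
  have "(M ** B) $ i = transpose B *v (M $ i)" for i
    by (simp add: vec_eq_iff matrix_matrix_mult_def matrix_vector_mult_def transpose_def mult.commute)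
  then show ?thesis using * by (simp add: norm_vec_def[of "M ** B"] norm_vec_def[of M])
qed

lemma norm_matrix_transpose: "norm (transpose M) = norm (M :: real^'n^'n)"
  apply (simp add: norm_vec_def L2_set_def transpose_def sum_nonneg)
  apply (rule sum.swap)
  done

lemma norm_orthogonal_mult_left:
  fixes M B :: "real^'n^'n"
  assumes "orthogonal_matrix B"
  shows "norm (B ** M) = norm M"
  using norm_orthogonal_mult_right[of "transpose B" "transpose M"] assms
  by (simp add: norm_matrix_transpose flip: matrix_transpose_mul)

lemma inv_orthogonal_group:
  "orthogonal_matrix A \<Longrightarrow> inv\<^bsub>orthogonal_group\<^esub> A = transpose A"
  by (intro group.inv_equality[OF group_orthogonal_group])
     (auto simp: orthogonal_group_def orthogonal_matrix_def)

lemma generate_orthogonal: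
  assumes "A \<subseteq> {M. orthogonal_matrix M}" "M \<in> generate orthogonal_group A"
  shows "orthogonal_matrix M"
  using group.generate_in_carrier[OF group_orthogonal_group, of A M] assms
  by (simp add: orthogonal_group_def)

lemma matrix_diff_ldistrib: "A ** (B - C) = A ** B - A ** (C :: real^'n^'n)"
  by (simp add: vec_eq_iff matrix_matrix_mult_def right_diff_distrib sum_subtractf)

lemma matrix_diff_rdistrib: "(B - C) ** A = B ** A - C ** (A :: real^'n^'n)"
  by (simp add: vec_eq_iff matrix_matrix_mult_def left_diff_distrib sum_subtractf)

lemma norm_diff_left_orthogonal:
  "orthogonal_matrix B \<Longrightarrow> norm (B ** M - B ** N) = norm (M - (N :: real^'n^'n))"
  by (metis matrix_diff_ldistrib norm_orthogonal_mult_left)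

lemma norm_diff_right_orthogonal:
  "orthogonal_matrix B \<Longrightarrow> norm (M ** B - N ** B) = norm (M - (N :: real^'n^'n))"
  by (metis matrix_diff_rdistrib norm_orthogonal_mult_right)

locale orthogonal_semigroup =
  fixes A :: "(real^'d^'d) set"
  assumes orth: "M \<in> A \<Longrightarrow> orthogonal_matrix M"
    and mult: "M \<in> A \<Longrightarrow> N \<in> A \<Longrightarrow> M ** N \<in> A"
    and nonempty: "A \<noteq> {}"
begin

lemma bounded_semigroup: "bounded A"
proof -
  have "norm M = norm (mat 1 :: real^'d^'d)" if "M \<in> A" for M
    using norm_orthogonal_mult_left[OF orth[OF that], of "mat 1"] by simp
  then show ?thesis by (auto simp: bounded_iff)
qed

text \<open>
  The powers of \<open>a\<close> are bounded, so two of them, with exponents at least two apart, are close to each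
  other. Cancelling the smaller power, some power of \<open>a\<close> is close to the identity, and the power
  before that is close to the inverse of \<open>a\<close>. The gap of two keeps the latter exponent positive.
\<close>
lemma approx_inverse:
  assumes a: "a \<in> A" and e: "0 < e"
  obtains b where "b \<in> A" "norm (b - transpose a) < e"
proof -
  \<comment> \<open>\<open>pw n\<close> is the power of \<open>a\<close> with exponent \<open>n + 1\<close>, since the semigroup may lack the identity.\<close>
  define pw where "pw n = ((\<lambda>M. a ** M) ^^ n) a" for n
  have pw_Suc: "pw (Suc n) = a ** pw n" for n by (simp add: pw_def)
  have pwA: "pw n \<in> A" for n
    by (induction n) (auto simp: pw_def a mult)
  have pw_add: "pw (Suc (m + n)) = pw m ** pw n" for m n
    by (induction m) (simp_all add: pw_Suc matrix_mul_assoc, simp add: pw_def)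
  have "bounded (range pw)" using bounded_subset[OF bounded_semigroup] pwA by blast
  then obtain l \<phi> where \<phi>: "strict_mono \<phi>" "(pw \<circ> \<phi>) \<longlonglongrightarrow> l"
    using bounded_imp_convergent_subsequence by blast
  from \<phi>(2) have "Cauchy (pw \<circ> \<phi>)" by (rule LIMSEQ_imp_Cauchy)
  then obtain N where N: "\<And>m n. m \<ge> N \<Longrightarrow> n \<ge> N \<Longrightarrow> norm (pw (\<phi> m) - pw (\<phi> n)) < e"
    using e unfolding Cauchy_iff comp_def by metis
  have "\<phi> N < \<phi> (Suc N)" "\<phi> (Suc N) < \<phi> (Suc (Suc N))" "\<phi> (Suc (Suc N)) < \<phi> (Suc (Suc (Suc N)))"
    using \<phi>(1) by (auto simp: strict_mono_def)
  then have "\<phi> N + 2 < \<phi> (Suc (Suc (Suc N)))" by simp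
  then obtain k where k: "\<phi> (Suc (Suc (Suc N))) = Suc (Suc k + \<phi> N)"
    using less_imp_add_positive[of "\<phi> N + 2"] by (metis add_2_eq_Suc' add_Suc add.commute add_Suc_shift less_iff_Suc_add)
  have "norm (pw (Suc (Suc k + \<phi> N)) - pw (\<phi> N)) < e"
    using N[of "Suc (Suc (Suc N))" N] k by simp
  then have "norm (pw (Suc k) ** pw (\<phi> N) - mat 1 ** pw (\<phi> N)) < e"
    using pw_add[of "Suc k" "\<phi> N"] by simp
  then have "norm (pw (Suc k) - mat 1) < e"
    by (subst (asm) norm_diff_right_orthogonal[OF orth[OF pwA]])
  then have "norm (a ** pw k - a ** transpose a) < e"
    using orth[OF a] by (simp add: pw_Suc orthogonal_matrix_def)
  then have "norm (pw k - transpose a) < e"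
    using norm_diff_left_orthogonal[OF orth[OF a]] by simp
  then show ?thesis using that pwA by blast
qed

lemma approx_mult:
  assumes M: "orthogonal_matrix M"
    and ap: "\<And>e. 0 < e \<Longrightarrow> \<exists>b\<in>A. norm (b - M) < e" "\<And>e. 0 < e \<Longrightarrow> \<exists>b\<in>A. norm (b - N) < e"
    and e: "0 < e"
  shows "\<exists>b\<in>A. norm (b - M ** N) < e"
proof -
  obtain b c where b: "b \<in> A" "norm (b - M) < e/2" and c: "c \<in> A" "norm (c - N) < e/2"
    using ap[of "e/2"] e by auto
  have "norm (b ** c - M ** N) \<le> norm (b ** c - M ** c) + norm (M ** c - M ** N)"
    using norm_triangle_ineq[of "b ** c - M ** c" "M ** c - M ** N"] by simp
  also have "\<dots> < e"
    using b c norm_diff_right_orthogonal[OF orth[OF c(1)], of b M] norm_diff_left_orthogonal[OF M, of c N]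
    by simp
  finally show ?thesis using mult[OF b(1) c(1)] by blast
qed

lemma generate_approx:
  assumes "M \<in> generate orthogonal_group A" "0 < e"
  shows "\<exists>b\<in>A. norm (b - M) < e"
  using assms
proof (induction arbitrary: e rule: generate.induct)
  case one
  obtain a where a: "a \<in> A" using nonempty by blast
  obtain b where "b \<in> A" "norm (b - transpose a) < e" using approx_inverse[OF a one] .
  then have "a ** b \<in> A" "norm (a ** b - mat 1) < e"
    using mult a norm_diff_left_orthogonal[OF orth[OF a], of b "transpose a"] orth[OF a]
    by (auto simp: orthogonal_matrix_def)
  then show ?case by (auto simp: orthogonal_group_def)
next
  case (incl h)
  then show ?case by (intro bexI[of _ h]) auto
next
  case (inv h)
  then show ?case
    using approx_inverse[of h e] by (metis inv_orthogonal_group orth)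
next
  case (eng h1 h2)
  have "orthogonal_matrix h1" using generate_orthogonal[OF _ eng(1)] orth by blast
  then have "\<exists>b\<in>A. norm (b - h1 ** h2) < e"
    using approx_mult eng by blast
  then show ?case by (simp add: orthogonal_group_def)
qed

text \<open>
  For a single \<open>a\<close>, choose \<open>w\<close> near \<open>transpose a ** h\<close>, where \<open>h\<close> is a group element near \<open>Q\<close>.
  The same \<open>w\<close> works for all matrices near \<open>a\<close>, and finitely many balls cover the semigroup.
\<close>
lemma finite_steering_set:
  assumes Q: "Q \<in> closure (generate orthogonal_group A)" and e: "0 < e"
  obtains W where "finite W" "W \<subseteq> A" "\<And>a. a \<in> A \<Longrightarrow> \<exists>w\<in>W. norm (a ** w - Q) < e"
proof -
  obtain h where h: "h \<in> generate orthogonal_group A" "norm (h - Q) < e/4"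
    using Q e by (auto simp: closure_approachable dist_norm dest!: spec[of _ "e/4"])
  have "\<exists>w\<in>A. norm (a ** w - Q) < e/2" if a: "a \<in> A" for a
  proof -
    have "inv\<^bsub>orthogonal_group\<^esub> a \<otimes>\<^bsub>orthogonal_group\<^esub> h \<in> generate orthogonal_group A"
      using a h by (intro generate.eng generate.inv)
    then have "transpose a ** h \<in> generate orthogonal_group A"
      using inv_orthogonal_group[OF orth[OF a]] by (simp add: orthogonal_group_def)
    then obtain w where w: "w \<in> A" "norm (w - transpose a ** h) < e/4"
      using generate_approx[of "transpose a ** h" "e/4"] e by auto
    have "a ** (transpose a ** h) = h"
      using orth[OF a] by (simp add: matrix_mul_assoc orthogonal_matrix_def)
    then have "norm (a ** w - h) < e/4"
      using norm_diff_left_orthogonal[OF orth[OF a], of w "transpose a ** h"] w by simp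
    then have "norm (a ** w - Q) < e/2"
      using h(2) norm_triangle_ineq[of "a ** w - h" "h - Q"] by simp
    then show ?thesis using w by blast
  qed
  then obtain w where w: "\<And>a. a \<in> A \<Longrightarrow> w a \<in> A \<and> norm (a ** w a - Q) < e/2" by metis
  have "compact (closure A)" using bounded_semigroup by simp
  moreover have "closure A \<subseteq> (\<Union>a\<in>A. ball a (e/2))"
    using e by (fastforce simp: closure_approachable dest!: spec[of _ "e/2"])
  ultimately obtain F where F: "F \<subseteq> A" "finite F" "closure A \<subseteq> (\<Union>a\<in>F. ball a (e/2))"
    using compactE_image[of "closure A" A "\<lambda>a. ball a (e/2)"] by auto
  show ?thesis
  proof (rule that[of "w ` F"])
    fix a assume a: "a \<in> A"
    then obtain g where g: "g \<in> F" "norm (g - a) < e/2"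
      using F(3) closure_subset[of A] by (force simp: dist_norm)
    have wg: "w g \<in> A" "norm (g ** w g - Q) < e/2" using w g(1) F(1) by auto
    have "norm (a ** w g - g ** w g) < e/2"
      using norm_diff_right_orthogonal[OF orth[OF wg(1)], of a g] g(2) by (simp add: norm_minus_commute)
    then have "norm (a ** w g - Q) < e"
      using wg(2) norm_triangle_ineq[of "a ** w g - g ** w g" "g ** w g - Q"] by simp
    then show "\<exists>w\<in>w ` F. norm (a ** w - Q) < e" using g by blast
  qed (use F w in auto)
qed

end


section \<open>Walks and cylinders of a graph directed system\<close>

lemma dist_similarity_map:
  assumes "contracting_similarity r T"
  shows "dist (similarity_map r T v x) (similarity_map r T v y) = r * dist x y"
proof -
  have "similarity_map r T v x - similarity_map r T v y = r *\<^sub>R (T *v (x - y))"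
    by (simp add: similarity_map_def matrix_vector_mult_diff_distrib scaleR_diff_right)
  then show ?thesis
    using assms by (simp add: dist_norm norm_orthogonal_mult_vector contracting_similarity_def)
qed

lemma similarity_map_comp:
  "similarity_map r T v (similarity_map r' T' v' x)
     = similarity_map (r * r') (T ** T') (similarity_map r T v v') x"
  by (simp add: similarity_map_def matrix_vector_right_distrib matrix_vector_mul_assoc
      matrix_vector_mult_scaleR scaleR_add_right)

lemma walk_matrix_append: "walk_matrix T (p @ q) = walk_matrix T p ** walk_matrix T q"
  by (induction p) (simp_all add: walk_matrix_def matrix_mul_assoc)

lemma prod_list_map_eq_prod_power_count:
  fixes r :: "'e \<Rightarrow> 'b::comm_monoid_mult"
  assumes "finite E" "set p \<subseteq> E"
  shows "prod_list (map r p) = (\<Prod>e\<in>E. r e ^ count_list p e)"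
  using assms(2)
proof (induction p)
  case (Cons a p)
  have "(\<Prod>e\<in>E. r e ^ count_list (a # p) e) = (\<Prod>e\<in>E. (if a = e then r e else 1) * r e ^ count_list p e)"
    by (intro prod.cong) auto
  also have "\<dots> = r a * (\<Prod>e\<in>E. r e ^ count_list p e)"
    using assms(1) Cons.prems by (simp add: prod.distrib)
  finally show ?case using Cons by simp
qed simp

text \<open>
  The product depends only on the multiplicities of the entries, so there are polynomially many
  values although there are exponentially many words.
\<close>
lemma card_prod_list_values:
  fixes r :: "'e \<Rightarrow> 'b::comm_monoid_mult"
  assumes E: "finite E"
  shows "card ((\<lambda>p. prod_list (map r p)) ` {p. set p \<subseteq> E \<and> length p = n}) \<le> (n + 1) ^ card E"
proof -
  have "(\<lambda>p. prod_list (map r p)) ` {p. set p \<subseteq> E \<and> length p = n}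
      \<subseteq> (\<lambda>k. \<Prod>e\<in>E. r e ^ k e) ` (E \<rightarrow>\<^sub>E {..n})"
  proof clarify
    fix p assume p: "set p \<subseteq> E" "n = length p"
    have "prod_list (map r p) = (\<Prod>e\<in>E. r e ^ restrict (count_list p) E e)"
      using prod_list_map_eq_prod_power_count[OF E p(1), of r] by simp
    moreover have "restrict (count_list p) E \<in> E \<rightarrow>\<^sub>E {..length p}"
      by (auto simp: count_le_length)
    ultimately show "prod_list (map r p) \<in> (\<lambda>k. \<Prod>e\<in>E. r e ^ k e) ` (E \<rightarrow>\<^sub>E {..length p})"
      by (rule rev_image_eqI[rotated])
  qed
  then have "card ((\<lambda>p. prod_list (map r p)) ` {p. set p \<subseteq> E \<and> length p = n})
      \<le> card ((\<lambda>k. \<Prod>e\<in>E. r e ^ k e) ` (E \<rightarrow>\<^sub>E {..n}))"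
    using E by (intro card_mono finite_imageI finite_PiE) auto
  also have "\<dots> \<le> card (E \<rightarrow>\<^sub>E {..n})"
    using E by (intro card_image_le finite_PiE) auto
  finally show ?thesis using E by (simp add: card_PiE)
qed

lemma powr_of_power:
  fixes R :: real
  assumes "0 < R"
  shows "(R ^ n) powr t = (R powr t) ^ n"
proof -
  have "(R ^ n) powr t = (R powr real n) powr t" using assms by (simp only: powr_realpow)
  also have "\<dots> = R powr (real n * t)" by (rule powr_powr)
  also have "\<dots> = (R powr t) ^ n" using assms by (simp add: powr_power mult.commute)
  finally show ?thesis .
qed

lemma poly_times_geometric_tendsto_0:
  fixes q :: real
  assumes "0 < q" "q < 1"
  shows "(\<lambda>n. real (n + 1) ^ k * q ^ n) \<longlonglongrightarrow> 0"
  using assms by real_asymp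

locale gd_system =
  fixes G :: "('v, 'e) pre_digraph"
    and r :: "'e \<Rightarrow> real" and T :: "'e \<Rightarrow> real^'d^'d" and v :: "'e \<Rightarrow> real^'d"
    and K :: "'v \<Rightarrow> (real^'d) set"
  assumes ifs: "gd_ifs G r T" and conn: "strongly_connected G" and attractor: "gd_attractor G r T v K"
begin

sublocale fin_digraph G
  using ifs by (simp add: gd_ifs_def)

definition ratio :: "'e list \<Rightarrow> real" where
  "ratio p = prod_list (map r p)"

definition walk_map :: "'e list \<Rightarrow> real^'d \<Rightarrow> real^'d" where
  "walk_map p = foldr (\<lambda>e. similarity_map (r e) (T e) (v e)) p"

definition cylinder :: "'v \<Rightarrow> 'e list \<Rightarrow> (real^'d) set" where
  "cylinder u p = walk_map p ` K (awlast u p)"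

lemma edge: "e \<in> arcs G \<Longrightarrow> contracting_similarity (r e) (T e)"
  using ifs by (simp add: gd_ifs_def)

lemma walk_map_simps [simp]:
  "walk_map [] x = x"
  "walk_map (e # p) x = similarity_map (r e) (T e) (v e) (walk_map p x)"
  "walk_map (p @ q) x = walk_map p (walk_map q x)"
  by (simp_all add: walk_map_def)

lemma ratio_simps [simp]:
  "ratio [] = 1" "ratio (e # p) = r e * ratio p" "ratio (p @ q) = ratio p * ratio q"
  by (simp_all add: ratio_def)

lemma ratio_pos: "set p \<subseteq> arcs G \<Longrightarrow> 0 < ratio p"
  by (induction p) (use edge in \<open>auto simp: contracting_similarity_def\<close>)

lemma ratio_le_power:
  assumes "\<And>e. e \<in> arcs G \<Longrightarrow> r e \<le> R"
  shows "set p \<subseteq> arcs G \<Longrightarrow> ratio p \<le> R ^ length p"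
proof (induction p)
  case (Cons e p)
  then show ?case
    using assms[of e] edge[of e] ratio_pos[of p]
    by (auto simp: contracting_similarity_def intro!: mult_mono)
qed simp

lemma max_ratio:
  obtains R where "0 < R" "R < 1" "\<And>p. set p \<subseteq> arcs G \<Longrightarrow> ratio p \<le> R ^ length p"
proof -
  define R where "R = Max (insert (1/2) (r ` arcs G))"
  have "R \<in> insert (1/2) (r ` arcs G)" unfolding R_def by (intro Max_in) auto
  moreover have "r e \<le> R" if "e \<in> arcs G" for e using that by (auto simp: R_def)
  moreover have "1/2 \<le> R" unfolding R_def by (intro Max_ge) auto
  ultimately show ?thesis
    using edge ratio_le_power that[of R] by (auto simp: contracting_similarity_def)
qed

lemma walk_matrix_orthogonal: "set p \<subseteq> arcs G \<Longrightarrow> orthogonal_matrix (walk_matrix T p)"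
  by (induction p)
     (use edge in \<open>auto simp: walk_matrix_def orthogonal_matrix_id contracting_similarity_def
        intro!: orthogonal_matrix_mul\<close>)

lemma walk_map_similarity:
  "walk_map p x = similarity_map (ratio p) (walk_matrix T p) (walk_map p 0) x"
proof (induction p)
  case Nil
  show ?case by (simp add: similarity_map_def walk_matrix_def)
next
  case (Cons e p)
  have "walk_map (e # p) x = similarity_map (r e) (T e) (v e)
      (similarity_map (ratio p) (walk_matrix T p) (walk_map p 0) x)"
    by (simp flip: Cons)
  then show ?case by (simp add: similarity_map_comp walk_matrix_def)
qed

lemma dist_walk_map:
  "set p \<subseteq> arcs G \<Longrightarrow> dist (walk_map p x) (walk_map p y) = ratio p * dist x y"
  by (induction p) (use edge in \<open>auto simp: dist_similarity_map\<close>)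

lemma K_compact: "u \<in> verts G \<Longrightarrow> compact (K u)"
  and K_nonempty: "u \<in> verts G \<Longrightarrow> K u \<noteq> {}"
  using attractor unfolding gd_attractor_def by blast+

lemma K_eq:
  "u \<in> verts G \<Longrightarrow> K u = (\<Union>e\<in>{e\<in>arcs G. tail G e = u}. similarity_map (r e) (T e) (v e) ` K (head G e))"
proof -
  assume u: "u \<in> verts G"
  then have "K u = (\<Union>w\<in>verts G. \<Union>e\<in>edges_between G u w. similarity_map (r e) (T e) (v e) ` K w)"
    using attractor unfolding gd_attractor_def by blast
  also have "\<dots> = (\<Union>e\<in>{e\<in>arcs G. tail G e = u}. similarity_map (r e) (T e) (v e) ` K (head G e))"
    unfolding edges_between_def using head_in_verts by blast
  finally show ?thesis .
qed

lemma walk_map_subset: "awalk u p w \<Longrightarrow> walk_map p ` K w \<subseteq> K u"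
proof (induction p arbitrary: u)
  case Nil
  then show ?case by (auto simp: awalk_Nil_iff)
next
  case (Cons e p)
  then have e: "e \<in> arcs G" "tail G e = u" "awalk (head G e) p w" by (auto simp: awalk_Cons_iff)
  then have "similarity_map (r e) (T e) (v e) ` K (head G e) \<subseteq> K u"
    using K_eq[of u] tail_in_verts[OF e(1)] by blast
  then show ?case using Cons.IH[OF e(3)] by auto
qed

lemma walk_cover:
  assumes "u \<in> verts G" "x \<in> K u"
  obtains p w where "awalk u p w" "length p = n" "x \<in> walk_map p ` K w"
proof -
  have "\<exists>p w. awalk u p w \<and> length p = n \<and> x \<in> walk_map p ` K w"
    using assms
  proof (induction n arbitrary: u x)
    case 0
    then show ?case by (intro exI[of _ "[]"] exI[of _ u]) (auto simp: awalk_Nil_iff)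
  next
    case (Suc n)
    then obtain e y where e: "e \<in> arcs G" "tail G e = u" "y \<in> K (head G e)"
      "x = similarity_map (r e) (T e) (v e) y" using K_eq[of u] by auto
    with Suc.IH[of "head G e" y] obtain p w where
      "awalk (head G e) p w" "length p = n" "y \<in> walk_map p ` K w" by auto
    with e show ?case
      by (intro exI[of _ "e # p"] exI[of _ w]) (auto simp: awalk_Cons_iff)
  qed
  then show ?thesis using that by blast
qed

lemma K_diam:
  obtains D where "0 < D" "\<forall>u\<in>verts G. \<forall>x\<in>K u. \<forall>y\<in>K u. dist x y \<le> D"
proof -
  have "bounded (\<Union>u\<in>verts G. K u)"
    using K_compact by (intro bounded_UN) (auto intro: compact_imp_bounded)
  then obtain D where D: "\<And>x y. x \<in> (\<Union>u\<in>verts G. K u) \<Longrightarrow> y \<in> (\<Union>u\<in>verts G. K u) \<Longrightarrow> dist x y \<le> D"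
    using diameter_bounded_bound by metis
  show ?thesis
    by (rule that[of "max D 1"]) (use D in \<open>auto intro: max.coboundedI1\<close>)
qed

lemma cylinder_awalk: "awalk u p w \<Longrightarrow> cylinder u p = walk_map p ` K w"
  by (simp add: cylinder_def)

lemma cylinder_diam:
  assumes D: "\<forall>u\<in>verts G. \<forall>x\<in>K u. \<forall>y\<in>K u. dist x y \<le> D"
    and p: "awalk u p w" and xy: "x \<in> cylinder u p" "y \<in> cylinder u p"
  shows "dist x y \<le> D * ratio p"
proof -
  obtain x' y' where "x = walk_map p x'" "y = walk_map p y'" "x' \<in> K w" "y' \<in> K w"
    using xy cylinder_awalk[OF p] by auto
  moreover have "set p \<subseteq> arcs G" "w \<in> verts G"
    using p awalk_last_in_verts by (auto simp: awalk_def)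
  ultimately show ?thesis using D ratio_pos[of p] by (simp add: dist_walk_map mult.commute)
qed

lemma finite_walks: "finite {p. (\<exists>w. awalk u p w) \<and> length p = n}"
  by (rule finite_subset[OF _ finite_lists_length_eq[OF finite_arcs, of n]]) (auto simp: awalk_def)

text \<open>
  Finiteness makes \<open>hausdorff_dim (K u) - \<epsilon>\<close> smaller than \<open>hausdorff_dim (K u)\<close>. It follows from
  covering \<open>K u\<close> by all cylinders of length \<open>n\<close>.
\<close>
lemma dim_finite:
  assumes u: "u \<in> verts G"
  shows "hausdorff_dim (K u) < \<infinity>"
proof -
  obtain R where R: "0 < R" "R < 1" "\<And>p. set p \<subseteq> arcs G \<Longrightarrow> ratio p \<le> R ^ length p"
    using max_ratio by metis
  obtain D where D: "0 < D" "\<forall>u\<in>verts G. \<forall>x\<in>K u. \<forall>y\<in>K u. dist x y \<le> D"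
    using K_diam by metis
  define N where "N = real (card (arcs G)) + 1"
  have N: "N \<ge> 1" by (simp add: N_def)
  \<comment> \<open>Chosen so that \<open>R powr t = 1 / (2 * N)\<close>: there are at most \<open>N ^ n\<close> cylinders of diameter at most
    \<open>D * R ^ n\<close>, and their sum of powers is then at most \<open>D powr t / 2 ^ n\<close>.\<close>
  define t where "t = ln (2 * N) / - ln R"
  have t: "0 < t" using N R by (auto simp: t_def intro!: divide_pos_pos divide_pos_neg)
  have "ln R \<noteq> 0" using R by simp
  then have tR: "t * ln R = - ln (2 * N)" by (simp add: t_def)
  have "R powr t = exp (t * ln R)" using R by (simp add: powr_def)
  also have "\<dots> = inverse (exp (ln (2 * N)))" unfolding tR by (rule exp_minus)
  also have "exp (ln (2 * N)) = 2 * N" by (rule exp_ln) (use N in linarith)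
  finally have "R powr t = inverse (2 * N)" .
  moreover have "N * inverse (2 * N) = 1/2" using N by (simp add: divide_simps)
  ultimately have NR: "N * R powr t = 1/2" by (simp only:)
  have "\<not> ereal t < hausdorff_dim (K u)"
  proof
    assume less: "ereal t < hausdorff_dim (K u)"
    obtain c \<delta> :: real where c: "0 < c" "0 < \<delta>"
      "\<forall>(J :: 'e list set) U d. finite J \<longrightarrow> K u \<subseteq> (\<Union>j\<in>J. U j) \<longrightarrow>
       (\<forall>j\<in>J. \<forall>x\<in>U j. \<forall>y\<in>U j. dist x y \<le> d j) \<longrightarrow> (\<forall>j\<in>J. 0 \<le> d j \<and> d j \<le> \<delta>) \<longrightarrow>
       c \<le> (\<Sum>j\<in>J. d j powr t)"
      using dim_gt_imp_finite_cover_sum_ge[OF t less, where 'i="'e list"] by blast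
    have "(\<lambda>n. D * R ^ n) \<longlonglongrightarrow> D * 0" "(\<lambda>n. D powr t * (1/2) ^ n) \<longlonglongrightarrow> D powr t * 0"
      using R by (intro tendsto_mult tendsto_const LIMSEQ_power_zero; simp)+
    then have "\<forall>\<^sub>F n in sequentially. D * R ^ n < \<delta>" "\<forall>\<^sub>F n in sequentially. D powr t * (1/2) ^ n < c"
      using order_tendstoD(2)[of _ "D * 0" _ \<delta>] order_tendstoD(2)[of _ "D powr t * 0" _ c] c by simp_all
    then have "\<forall>\<^sub>F n in sequentially. D * R ^ n < \<delta> \<and> D powr t * (1/2) ^ n < c"
      by eventually_elim auto
    then obtain n where n: "D * R ^ n < \<delta>" "D powr t * (1/2) ^ n < c"
      using eventually_happens'[OF sequentially_bot] by blast
    define J where "J = {p. (\<exists>w. awalk u p w) \<and> length p = n}"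
    have "c \<le> (\<Sum>p\<in>J. (D * R ^ n) powr t)"
    proof (rule c(3)[rule_format, of J "cylinder u"])
      show "finite J" unfolding J_def by (rule finite_walks)
      show "K u \<subseteq> (\<Union>p\<in>J. cylinder u p)"
      proof
        fix x assume "x \<in> K u"
        then obtain p w where "awalk u p w" "length p = n" "x \<in> walk_map p ` K w"
          by (rule walk_cover[OF u])
        then have "p \<in> J" "x \<in> cylinder u p" using cylinder_awalk by (auto simp: J_def)
        then show "x \<in> (\<Union>p\<in>J. cylinder u p)" by blast
      qed
      show "dist x y \<le> D * R ^ n" if pxy: "p \<in> J" "x \<in> cylinder u p" "y \<in> cylinder u p" for p x y
      proof -
        obtain w where w: "awalk u p w" "length p = n" using pxy by (auto simp: J_def)
        then have "ratio p \<le> R ^ n" using R(3)[of p] by (auto simp: awalk_def)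
        then show ?thesis
          using cylinder_diam[OF D(2) w(1) pxy(2,3)] D(1) by (meson mult_left_mono order_trans less_imp_le)
      qed
      show "0 \<le> D * R ^ n \<and> D * R ^ n \<le> \<delta>" using D R n by simp
    qed
    also have "\<dots> = real (card J) * (D powr t * (R powr t) ^ n)"
      using D R by (simp add: powr_mult powr_of_power)
    also have "\<dots> \<le> N ^ n * (D powr t * (R powr t) ^ n)"
    proof (intro mult_right_mono)
      have "card J \<le> card {p. set p \<subseteq> arcs G \<and> length p = n}"
        by (intro card_mono finite_lists_length_eq) (auto simp: J_def awalk_def)
      also have "\<dots> = card (arcs G) ^ n" by (simp add: card_lists_length_eq)
      finally have "real (card J) \<le> real (card (arcs G)) ^ n" by (metis of_nat_le_iff of_nat_power)
      also have "\<dots> \<le> N ^ n" by (intro power_mono) (auto simp: N_def)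
      finally show "real (card J) \<le> N ^ n" .
    qed (use D R in auto)
    also have "\<dots> = D powr t * (1/2) ^ n"
      unfolding NR[symmetric] by (simp only: power_mult_distrib mult.left_commute)
    finally show False using n by simp
  qed
  then have "hausdorff_dim (K u) \<le> ereal t" by (simp add: not_less)
  also have "\<dots> < \<infinity>" by simp
  finally show ?thesis .
qed

section \<open>Packing cylinders of equal ratio\<close>

text \<open>
  Many walks with disjoint cylinders, one ratio and one label. The label is arbitrary here, with
  finitely many values; it stands for the choice of a prolongation of the walk.
\<close>
lemma homogeneous_packing:
  fixes lab :: "'e list \<Rightarrow> 'l"
  assumes u: "u \<in> verts G" and t: "0 \<le> t" "t < t'" "ereal t' < hausdorff_dim (K u)"
    and L: "finite L" "\<forall>p w. awalk u p w \<longrightarrow> p \<noteq> [] \<longrightarrow> lab p \<in> L"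
    and B: "0 < B"
  obtains F \<rho> l where "finite F" "\<And>p. p \<in> F \<Longrightarrow> (\<exists>w. awalk u p w) \<and> p \<noteq> [] \<and> ratio p = \<rho> \<and> lab p = l"
    "disjoint_family_on (cylinder u) F" "B \<le> real (card F) * \<rho> powr t"
proof -
  obtain R where R: "0 < R" "R < 1" "\<And>p. set p \<subseteq> arcs G \<Longrightarrow> ratio p \<le> R ^ length p"
    using max_ratio by metis
  obtain D where D: "0 < D" "\<forall>u\<in>verts G. \<forall>x\<in>K u. \<forall>y\<in>K u. dist x y \<le> D"
    using K_diam by metis
  have t'_pos: "0 < t'" using t by simp
  obtain c \<delta> :: real where c: "0 < c" "0 < \<delta>"
    "\<forall>(J :: 'e list set) U d. finite J \<longrightarrow> K u \<subseteq> (\<Union>j\<in>J. U j) \<longrightarrow>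
     (\<forall>j\<in>J. \<forall>x\<in>U j. \<forall>y\<in>U j. dist x y \<le> d j) \<longrightarrow> (\<forall>j\<in>J. 0 \<le> d j \<and> d j \<le> \<delta>) \<longrightarrow>
     c \<le> (\<Sum>j\<in>J. d j powr t')"
    using dim_gt_imp_finite_cover_sum_ge[OF t'_pos t(3), where 'i="'e list"] by blast
  define E where "E = card (arcs G)"
  define q where "q = R powr (t' - t)"
  have q: "0 < q" "q < 1"
    using R t by (auto simp: q_def powr01_less_one)
  define C where "C = real (card L) * (B * (3 * D) powr t')"
  have "(\<lambda>n. 3 * D * R ^ n) \<longlonglongrightarrow> 3 * D * 0"
    using R by (intro tendsto_mult tendsto_const LIMSEQ_power_zero) auto
  then have "\<forall>\<^sub>F n in sequentially. 3 * D * R ^ n < \<delta>"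
    using c by (auto dest!: order_tendstoD(2)[where a=\<delta>])
  moreover have "(\<lambda>n. C * (real (n + 1) ^ E * q ^ n)) \<longlonglongrightarrow> C * 0"
    using q by (intro tendsto_mult tendsto_const poly_times_geometric_tendsto_0)
  then have "\<forall>\<^sub>F n in sequentially. C * (real (n + 1) ^ E * q ^ n) < c"
    using c by (auto dest!: order_tendstoD(2)[where a=c])
  moreover have "\<forall>\<^sub>F n :: nat in sequentially. n \<ge> 1" by (rule eventually_ge_at_top)
  ultimately have "\<forall>\<^sub>F n in sequentially. 3 * D * R ^ n < \<delta> \<and> C * (real (n + 1) ^ E * q ^ n) < c \<and> n \<ge> 1"
    by eventually_elim auto
  then obtain n where n: "3 * D * R ^ n < \<delta>" "C * (real (n + 1) ^ E * q ^ n) < c" "n \<ge> 1"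
    using eventually_happens'[OF sequentially_bot] by blast
  define W where "W = {p. (\<exists>w. awalk u p w) \<and> length p = n}"
  have finW: "finite W" unfolding W_def by (rule finite_walks)
  have W_arcs: "set p \<subseteq> arcs G" "length p = n" "p \<noteq> []" if "p \<in> W" for p
    using that n(3) by (auto simp: W_def awalk_def)
  have ratioW: "0 < ratio p" "ratio p \<le> R ^ n" if "p \<in> W" for p
    using ratio_pos R(3) W_arcs[OF that] by auto
  define key where "key p = (ratio p, lab p)" for p
  define good where "good J \<longleftrightarrow> J \<subseteq> W \<and>
    (\<forall>p\<in>J. \<forall>p'\<in>J. p \<noteq> p' \<longrightarrow> key p = key p' \<longrightarrow> cylinder u p \<inter> cylinder u p' = {})" for J
  have "finite {J. good J}"
    by (rule finite_subset[of _ "Pow W"]) (use finW in \<open>auto simp: good_def\<close>)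
  moreover have "{J. good J} \<noteq> {}" by (auto simp: good_def intro!: exI[of _ "{}"])
  ultimately obtain J where J: "good J" "\<And>J'. good J' \<Longrightarrow> J \<subseteq> J' \<Longrightarrow> J = J'"
    using finite_has_maximal[of "{J. good J}"] by (metis mem_Collect_eq)
  have JW: "J \<subseteq> W" using J(1) by (simp add: good_def)
  have finJ: "finite J" using finW JW by (rule finite_subset[rotated])
  \<comment> \<open>Any cylinder meeting \<open>cylinder u p\<close> and having the same ratio lies in \<open>U p\<close>, whose diameter is
    at most three times the bound for a cylinder.\<close>
  define U where "U p = {x. \<exists>y\<in>cylinder u p. dist x y \<le> D * ratio p}" for p
  have cdiam: "dist x y \<le> D * ratio p" if "p \<in> W" "x \<in> cylinder u p" "y \<in> cylinder u p" for p x y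
    using cylinder_diam[OF D(2)] that by (auto simp: W_def)
  have "c \<le> (\<Sum>p\<in>J. (3 * D * ratio p) powr t')"
  proof (rule c(3)[rule_format, OF finJ, of U])
    show "K u \<subseteq> (\<Union>p\<in>J. U p)"
    proof
      fix x assume "x \<in> K u"
      then obtain p' w where "awalk u p' w" "length p' = n" "x \<in> walk_map p' ` K w"
        by (rule walk_cover[OF u])
      then have p': "p' \<in> W" "x \<in> cylinder u p'" using cylinder_awalk by (auto simp: W_def)
      have "\<exists>p\<in>J. key p = key p' \<and> cylinder u p \<inter> cylinder u p' \<noteq> {}"
      proof (cases "p' \<in> J")
        case True
        then show ?thesis using p' by (intro bexI[of _ p']) auto
      next
        case False
        then have "\<not> good (insert p' J)" using J(2)[of "insert p' J"] by auto
        then show ?thesis using p'(1) J(1) unfolding good_def by (auto simp: Int_commute)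
      qed
      then obtain p y where p: "p \<in> J" "key p = key p'" "y \<in> cylinder u p" "y \<in> cylinder u p'" by auto
      then have "dist x y \<le> D * ratio p" using cdiam[OF p'(1,2)] by (auto simp: key_def)
      then show "x \<in> (\<Union>p\<in>J. U p)" using p by (auto simp: U_def)
    qed
    show "dist x y \<le> 3 * D * ratio p" if p: "p \<in> J" "x \<in> U p" "y \<in> U p" for p x y
    proof -
      obtain x' y' where 1: "x' \<in> cylinder u p" "y' \<in> cylinder u p" "dist x x' \<le> D * ratio p" "dist y y' \<le> D * ratio p"
        using p by (auto simp: U_def)
      have "dist x' y' \<le> D * ratio p" using cdiam 1 p JW by blast
      moreover have "dist x y \<le> dist x x' + dist x' y' + dist y y'"
        by (smt (verit) dist_commute dist_triangle)
      ultimately show ?thesis using 1 by (simp add: field_simps)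
    qed
    show "0 \<le> 3 * D * ratio p \<and> 3 * D * ratio p \<le> \<delta>" if "p \<in> J" for p
    proof -
      have p: "p \<in> W" using that JW by blast
      have "3 * D * ratio p \<le> 3 * D * R ^ n"
        using ratioW[OF p] D(1) by (intro mult_left_mono) auto
      also have "\<dots> \<le> \<delta>" using n(1) by simp
      finally show ?thesis using D(1) ratioW[OF p] by simp
    qed
  qed
  define F where "F k = {p \<in> J. key p = k}" for k
  have finF: "finite (F k)" for k using finJ by (simp add: F_def)
  have "\<exists>k\<in>key ` J. B \<le> real (card (F k)) * fst k powr t"
  proof (rule ccontr)
    assume no: "\<not> ?thesis"
    \<comment> \<open>Otherwise every label contributes at most \<open>B * (3 * D) powr t' * q ^ n\<close>, and summing over the
      polynomially many labels contradicts the lower bound for covers.\<close>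
    have "(\<Sum>p\<in>J. (3 * D * ratio p) powr t') = (\<Sum>k\<in>key ` J. \<Sum>p\<in>F k. (3 * D * ratio p) powr t')"
      unfolding F_def using finJ by (intro sum.group[symmetric]) auto
    also have "\<dots> \<le> (\<Sum>k\<in>key ` J. B * (3 * D) powr t' * q ^ n)"
    proof (rule sum_mono)
      fix k assume k: "k \<in> key ` J"
      then obtain p0 where p0: "p0 \<in> J" "k = key p0" by auto
      then have f: "0 < fst k" "fst k \<le> R ^ n" using ratioW JW by (auto simp: key_def)
      have "(\<Sum>p\<in>F k. (3 * D * ratio p) powr t') = (\<Sum>p\<in>F k. (3 * D * fst k) powr t')"
        by (intro sum.cong) (auto simp: F_def key_def)
      also have "\<dots> = (real (card (F k)) * fst k powr t) * (3 * D) powr t' * fst k powr (t' - t)"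
        using f D(1) by (simp add: powr_mult powr_diff)
      also have "\<dots> \<le> B * (3 * D) powr t' * q ^ n"
      proof (intro mult_mono)
        show "real (card (F k)) * fst k powr t \<le> B" using no k by auto
        have "fst k powr (t' - t) \<le> (R ^ n) powr (t' - t)" using f t by (intro powr_mono2) auto
        also have "\<dots> = q ^ n" unfolding q_def using R(1) by (rule powr_of_power)
        finally show "fst k powr (t' - t) \<le> q ^ n" .
      qed (use B in auto)
      finally show "(\<Sum>p\<in>F k. (3 * D * ratio p) powr t') \<le> B * (3 * D) powr t' * q ^ n" .
    qed
    also have "\<dots> = real (card (key ` J)) * (B * (3 * D) powr t' * q ^ n)" by simp
    also have "\<dots> \<le> (real (n + 1) ^ E * real (card L)) * (B * (3 * D) powr t' * q ^ n)"
    proof (intro mult_right_mono)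
      let ?V = "(\<lambda>p. prod_list (map r p)) ` {p. set p \<subseteq> arcs G \<and> length p = n}"
      have "finite ?V" by (intro finite_imageI finite_lists_length_eq) simp
      moreover have "key ` J \<subseteq> ?V \<times> L"
      proof
        fix k assume "k \<in> key ` J"
        then obtain p where p: "p \<in> W" "k = key p" using JW by auto
        then have "lab p \<in> L" using L(2) W_arcs[OF p(1)] by (auto simp: W_def)
        then show "k \<in> ?V \<times> L" using p W_arcs[OF p(1)] by (auto simp: key_def ratio_def)
      qed
      ultimately have "card (key ` J) \<le> card (?V \<times> L)" using L(1) by (intro card_mono) auto
      also have "\<dots> = card ?V * card L" by (rule card_cartesian_product)
      also have "\<dots> \<le> (n + 1) ^ E * card L"
        unfolding E_def by (intro mult_right_mono card_prod_list_values) auto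
      finally show "real (card (key ` J)) \<le> real (n + 1) ^ E * real (card L)"
        by (metis of_nat_le_iff of_nat_mult of_nat_power)
    qed (use B q in auto)
    also have "\<dots> = C * (real (n + 1) ^ E * q ^ n)" by (simp add: C_def mult_ac)
    finally show False using n(2) \<open>c \<le> (\<Sum>p\<in>J. (3 * D * ratio p) powr t')\<close> by simp
  qed
  then obtain k where k: "k \<in> key ` J" "B \<le> real (card (F k)) * fst k powr t" by blast
  show ?thesis
  proof (rule that[of "F k" "fst k" "snd k"])
    show "finite (F k)" by (rule finF)
    show "(\<exists>w. awalk u p w) \<and> p \<noteq> [] \<and> ratio p = fst k \<and> lab p = snd k" if "p \<in> F k" for p
    proof -
      have "p \<in> W" "key p = k" using that JW by (auto simp: F_def)
      then show ?thesis using W_arcs[of p] by (auto simp: W_def key_def)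
    qed
    show "disjoint_family_on (cylinder u) (F k)"
      using J(1) by (auto simp: disjoint_family_on_def good_def F_def)
  qed (rule k(2))
qed

section \<open>Approximation by self-similar systems\<close>

lemma homogeneous_cycles_ss_ifs:
  assumes j: "j \<in> verts G" and F: "finite F" "F \<noteq> {}"
    and cyc: "\<And>p. p \<in> F \<Longrightarrow> awalk j p j \<and> p \<noteq> [] \<and> ratio p = \<rho>"
    and disj: "disjoint_family_on (\<lambda>p. walk_map p ` K j) F"
    and dim: "1 \<le> real (card F) * \<rho> powr t"
  obtains m T' v' K' where "0 < \<rho>" "\<rho> < 1" "ss_ifs m (\<lambda>_. \<rho>) T'" "ss_attractor m (\<lambda>_. \<rho>) T' v' K'"
    "strong_separation m (\<lambda>_. \<rho>) T' v' K'" "K' \<subseteq> K j" "ereal t \<le> hausdorff_dim K'"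
    "\<And>i. i \<in> {1..m} \<Longrightarrow> T' i \<in> walk_matrix T ` F"
proof -
  obtain R where R: "0 < R" "R < 1" "\<And>p. set p \<subseteq> arcs G \<Longrightarrow> ratio p \<le> R ^ length p"
    using max_ratio by metis
  have Farcs: "set p \<subseteq> arcs G" if "p \<in> F" for p using cyc[OF that] by (auto simp: awalk_def)
  have \<rho>: "0 < \<rho>" "\<rho> < 1"
  proof -
    obtain p where p: "p \<in> F" using F by auto
    show "0 < \<rho>" using ratio_pos[OF Farcs[OF p]] cyc[OF p] by simp
    have "\<rho> \<le> R ^ length p" using R(3)[OF Farcs[OF p]] cyc[OF p] by simp
    also have "\<dots> \<le> R ^ 1" using R(1,2) cyc[OF p] by (intro power_decreasing) (auto simp: Suc_le_eq)
    also have "\<dots> < 1" using R(2) by simp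
    finally show "\<rho> < 1" .
  qed
  define m where "m = card F"
  have m: "1 \<le> m" using F by (simp add: m_def Suc_le_eq card_gt_0_iff)
  obtain h where h: "bij_betw h {1..m} F"
    using ex_bij_betw_nat_finite_1[OF F(1)] by (auto simp: m_def)
  have hF: "h i \<in> F" if "i \<in> {1..m}" for i using h that by (auto simp: bij_betw_def)
  define T' where "T' i = walk_matrix T (h i)" for i
  define v' where "v' i = walk_map (h i) 0" for i
  have map_eq: "similarity_map \<rho> (T' i) (v' i) = walk_map (h i)" if "i \<in> {1..m}" for i
  proof
    fix x
    have "ratio (h i) = \<rho>" using cyc[OF hF[OF that]] by blast
    then show "similarity_map \<rho> (T' i) (v' i) x = walk_map (h i) x"
      by (simp only: walk_map_similarity[of "h i" x] T'_def v'_def)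
  qed
  interpret separated_homogeneous_ifs "{1..m}" "\<lambda>i. walk_map (h i)" \<rho> "K j"
  proof
    show "dist (walk_map (h i) x) (walk_map (h i) y) = \<rho> * dist x y" if "i \<in> {1..m}" for i x y
      using dist_walk_map[OF Farcs[OF hF[OF that]]] cyc[OF hF[OF that]] by simp
    show "walk_map (h i) ` K j \<subseteq> K j" if "i \<in> {1..m}" for i
      using walk_map_subset cyc[OF hF[OF that]] by blast
    show "disjoint_family_on (\<lambda>i. walk_map (h i) ` K j) {1..m}"
      unfolding disjoint_family_on_def
    proof (intro ballI impI)
      fix i k assume ik: "i \<in> {1..m}" "k \<in> {1..m}" "i \<noteq> k"
      then have "h i \<noteq> h k" using inj_onD[OF bij_betw_imp_inj_on[OF h]] by metis
      then show "walk_map (h i) ` K j \<inter> walk_map (h k) ` K j = {}"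
        using disj hF ik unfolding disjoint_family_on_def by blast
    qed
  qed (use m \<rho> K_compact[OF j] K_nonempty[OF j] in auto)
  show ?thesis
  proof (rule that[OF \<rho>, of m T' v' limit_set])
    show "ss_ifs m (\<lambda>_. \<rho>) T'"
      using m \<rho> walk_matrix_orthogonal[OF Farcs[OF hF]]
      by (simp add: ss_ifs_def contracting_similarity_def T'_def)
    show "ss_attractor m (\<lambda>_. \<rho>) T' v' limit_set"
      unfolding ss_attractor_def
    proof (intro conjI limit_set_nonempty limit_set_compact)
      have "limit_set = (\<Union>i\<in>{1..m}. walk_map (h i) ` limit_set)" by (rule limit_set_fixed)
      also have "\<dots> = (\<Union>i\<in>{1..m}. similarity_map \<rho> (T' i) (v' i) ` limit_set)"
        by (rule SUP_cong[OF refl]) (simp only: map_eq)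
      finally show "limit_set = (\<Union>i\<in>{1..m}. similarity_map \<rho> (T' i) (v' i) ` limit_set)" .
    qed
    show "strong_separation m (\<lambda>_. \<rho>) T' v' limit_set"
      using disj_limit_set map_eq by (simp add: strong_separation_def disjoint_family_on_def)
    show "ereal t \<le> hausdorff_dim limit_set"
      using dim by (intro limit_set_dim_ge) (simp add: m_def)
    show "T' i \<in> walk_matrix T ` F" if "i \<in> {1..m}" for i using hF[OF that] by (simp add: T'_def)
  qed (rule limit_set_subset)
qed

lemma exists_walk: "u \<in> verts G \<Longrightarrow> w \<in> verts G \<Longrightarrow> \<exists>p. awalk u p w"
  using conn by (simp add: strongly_connected_def reachable_awalk)

text \<open>
  A walk \<open>p\<close> from \<open>j\<close> to \<open>w\<close> is first closed up by a fixed walk \<open>b w\<close> back to \<open>j\<close>, then its matrix is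
  corrected by one of finitely many cycles.
\<close>
lemma steering_walks:
  assumes j: "j \<in> verts G" and Q: "Q \<in> closure (transformation_group G T j)" and e: "0 < e"
  obtains Z where "finite Z"
    "\<And>p w. awalk j p w \<Longrightarrow> p \<noteq> [] \<Longrightarrow> \<exists>z\<in>Z. awalk w z j \<and> norm (walk_matrix T (p @ z) - Q) < e"
proof -
  define A where "A = walk_matrix T ` directed_cycles G j"
  have cyc: "p \<in> directed_cycles G j \<longleftrightarrow> p \<noteq> [] \<and> awalk j p j" for p
    by (simp add: directed_cycles_def)
  interpret orthogonal_semigroup A
  proof
    show "orthogonal_matrix M" if "M \<in> A" for M
      using that walk_matrix_orthogonal by (auto simp: A_def cyc awalk_def)
    show "M ** N \<in> A" if "M \<in> A" "N \<in> A" for M N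
    proof -
      obtain p q where "p \<noteq> []" "awalk j p j" "M = walk_matrix T p" "awalk j q j" "N = walk_matrix T q"
        using \<open>M \<in> A\<close> \<open>N \<in> A\<close> by (auto simp: A_def cyc)
      then have "p @ q \<in> directed_cycles G j" "M ** N = walk_matrix T (p @ q)"
        by (auto simp: cyc walk_matrix_append intro: awalk_appendI)
      then show ?thesis by (auto simp: A_def)
    qed
    obtain a where a: "a \<in> arcs G" "tail G a = j" using ifs j by (auto simp: gd_ifs_def)
    obtain p where "awalk (head G a) p j" using exists_walk[of "head G a" j] a j by auto
    then have "a # p \<in> directed_cycles G j" using a j by (auto simp: cyc awalk_Cons_iff)
    then show "A \<noteq> {}" by (auto simp: A_def)
  qed
  obtain W where W: "finite W" "W \<subseteq> A" "\<And>a. a \<in> A \<Longrightarrow> \<exists>w\<in>W. norm (a ** w - Q) < e"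
    using finite_steering_set[of Q e] Q e by (auto simp: A_def transformation_group_def)
  obtain Y where Y: "finite Y" "Y \<subseteq> directed_cycles G j" "W = walk_matrix T ` Y"
    using finite_subset_image[OF W(1)] W(2) unfolding A_def by metis
  obtain b where b: "\<And>w. w \<in> verts G \<Longrightarrow> awalk w (b w) j"
    using bchoice[of "verts G" "\<lambda>w p. awalk w p j"] exists_walk[OF _ j] by blast
  show ?thesis
  proof (rule that[of "(\<lambda>(w, y). b w @ y) ` (verts G \<times> Y)"])
    fix p w assume p: "awalk j p w" "p \<noteq> []"
    then have w: "w \<in> verts G" by (simp add: awalk_last_in_verts)
    have "p @ b w \<in> directed_cycles G j" using p b[OF w] by (auto simp: cyc intro: awalk_appendI)
    then have "walk_matrix T (p @ b w) \<in> A" by (auto simp: A_def)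
    then obtain y where y: "y \<in> Y" "norm (walk_matrix T (p @ b w) ** walk_matrix T y - Q) < e"
      using W(3) Y(3) by blast
    then have "awalk w (b w @ y) j" using b[OF w] Y(2) by (auto simp: cyc intro: awalk_appendI)
    with y w show "\<exists>z\<in>(\<lambda>(w, y). b w @ y) ` (verts G \<times> Y). awalk w z j \<and> norm (walk_matrix T (p @ z) - Q) < e"
      by (intro bexI[of _ "b w @ y"]) (auto simp: walk_matrix_append matrix_mul_assoc)
  qed (use Y in auto)
qed

text \<open>
  For \<open>t = 0\<close> a single cycle is enough. For \<open>t > 0\<close>, the packing lemma is applied with the label \<open>lab p\<close>
  being a walk that prolongs \<open>p\<close> to a cycle with matrix near \<open>Q\<close>. Since all selected walks have the
  same label \<open>z\<close>, the prolonged cycles still have a common ratio, and the images of \<open>K j\<close> stay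
  disjoint because they lie in the cylinders of the shorter walks.
\<close>
lemma homogeneous_separated_cycles:
  assumes j: "j \<in> verts G" and Q: "Q \<in> closure (transformation_group G T j)" and e: "0 < e"
    and t: "0 \<le> t" "t = 0 \<or> ereal t < hausdorff_dim (K j)"
  obtains F \<rho> where "finite F" "F \<noteq> {}" "\<And>p. p \<in> F \<Longrightarrow> awalk j p j \<and> p \<noteq> [] \<and> ratio p = \<rho>"
    "disjoint_family_on (\<lambda>p. walk_map p ` K j) F" "1 \<le> real (card F) * \<rho> powr t"
    "\<And>p. p \<in> F \<Longrightarrow> norm (walk_matrix T p - Q) < e"
proof -
  obtain Z where Z: "finite Z"
    "\<And>p w. awalk j p w \<Longrightarrow> p \<noteq> [] \<Longrightarrow> \<exists>z\<in>Z. awalk w z j \<and> norm (walk_matrix T (p @ z) - Q) < e"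
    using steering_walks[OF j Q e] by metis
  show ?thesis
  proof (cases "t = 0")
    case True
    obtain a where a: "a \<in> arcs G" "tail G a = j" using ifs j by (auto simp: gd_ifs_def)
    then have "awalk j [a] (head G a)" using arc_implies_awalk by blast
    then obtain z where z: "awalk (head G a) z j" "norm (walk_matrix T ([a] @ z) - Q) < e"
      using Z(2)[of "[a]"] by blast
    have c: "awalk j (a # z) j" using z a j by (auto simp: awalk_Cons_iff)
    then have "0 < ratio (a # z)" by (intro ratio_pos) (auto simp: awalk_def)
    then show ?thesis
      using that[of "{a # z}" "ratio (a # z)"] True z c
      by (simp add: disjoint_family_on_def del: ratio_simps)
  next
    case False
    then obtain t' where t': "t < t'" "ereal t' < hausdorff_dim (K j)"
      using t ereal_dense2[of "ereal t" "hausdorff_dim (K j)"] by auto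
    define good where "good p z \<longleftrightarrow> z \<in> Z \<and> (\<exists>w. awalk j p w \<and> awalk w z j) \<and>
      norm (walk_matrix T (p @ z) - Q) < e" for p z
    define lab where "lab p = (SOME z. good p z)" for p
    have lab: "good p (lab p)" if "awalk j p w" "p \<noteq> []" for p w
      unfolding lab_def using Z(2)[OF that] that by (intro someI_ex[of "good p"]) (auto simp: good_def)
    define L where "L = {z \<in> Z. set z \<subseteq> arcs G}"
    have labL: "\<forall>p w. awalk j p w \<longrightarrow> p \<noteq> [] \<longrightarrow> lab p \<in> L"
      using lab by (fastforce simp: L_def good_def awalk_def)
    \<comment> \<open>A lower bound for the ratios of the prolongations, which the factor \<open>1 / \<zeta> powr t\<close> in the packing
      compensates; the \<open>1\<close> keeps the set nonempty.\<close>
    define \<zeta> where "\<zeta> = Min (insert 1 (ratio ` L))"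
    have finL: "finite L" using Z(1) by (simp add: L_def)
    have \<zeta>: "0 < \<zeta>" unfolding \<zeta>_def using finL ratio_pos by (subst Min_gr_iff) (auto simp: L_def)
    obtain F \<rho> z where F: "finite F"
      "\<And>p. p \<in> F \<Longrightarrow> (\<exists>w. awalk j p w) \<and> p \<noteq> [] \<and> ratio p = \<rho> \<and> lab p = z"
      "disjoint_family_on (cylinder j) F" "1 / \<zeta> powr t \<le> real (card F) * \<rho> powr t"
      using homogeneous_packing[OF j t(1) t' finL labL, where B="1 / \<zeta> powr t"] \<zeta>
      by (metis zero_less_divide_1_iff powr_gt_zero less_irrefl)
    have "F \<noteq> {}" using F(4) \<zeta> by (auto simp: field_simps)
    then obtain p0 where p0: "p0 \<in> F" by auto
    have good: "good p z" if "p \<in> F" for p using F(2)[OF that] lab by auto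
    have zL: "z \<in> L" using F(2)[OF p0] labL by auto
    have \<rho>: "0 < \<rho>" using F(2)[OF p0] ratio_pos[of p0] by (auto simp: awalk_def)
    have \<zeta>z: "\<zeta> \<le> ratio z" unfolding \<zeta>_def using finL zL by (intro Min_le) auto
    show ?thesis
    proof (rule that[of "(\<lambda>p. p @ z) ` F" "\<rho> * ratio z"])
      show "awalk j q j \<and> q \<noteq> [] \<and> ratio q = \<rho> * ratio z" if "q \<in> (\<lambda>p. p @ z) ` F" for q
        using that good F(2) by (auto simp: good_def intro: awalk_appendI)
      show "norm (walk_matrix T q - Q) < e" if "q \<in> (\<lambda>p. p @ z) ` F" for q
        using that good by (auto simp: good_def)
      have sub: "walk_map (p @ z) ` K j \<subseteq> cylinder j p" if p: "p \<in> F" for p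
      proof -
        obtain w where w: "awalk j p w" "awalk w z j" using good[OF p] by (auto simp: good_def)
        then show ?thesis using walk_map_subset[OF w(2)] by (auto simp: cylinder_awalk)
      qed
      then show "disjoint_family_on (\<lambda>p. walk_map p ` K j) ((\<lambda>p. p @ z) ` F)"
        using F(3) unfolding disjoint_family_on_def by (simp add: ball_simps) blast
      have "1 \<le> real (card F) * \<rho> powr t * \<zeta> powr t" using F(4) \<zeta> by (simp add: field_simps)
      also have "\<dots> \<le> real (card F) * \<rho> powr t * ratio z powr t"
        using \<zeta> \<zeta>z t(1) by (intro mult_left_mono powr_mono2) auto
      also have "\<dots> = real (card ((\<lambda>p. p @ z) ` F)) * (\<rho> * ratio z) powr t"
        by (simp add: card_image inj_on_def powr_mult mult.assoc)
      finally show "1 \<le> real (card ((\<lambda>p. p @ z) ` F)) * (\<rho> * ratio z) powr t" .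
    qed (use F(1) \<open>F \<noteq> {}\<close> in auto)
  qed
qed

end

theorem theorem1p3:
  fixes G :: "(nat, 'e) pre_digraph"
    and q j :: nat
    and r :: "'e \<Rightarrow> real"
    and T :: "'e \<Rightarrow> real^'d^'d"
    and v :: "'e \<Rightarrow> real^'d"
    and K :: "nat \<Rightarrow> (real^'d) set"
  assumes "verts G = {1..q}"
    and "gd_ifs G r T"
    and "strongly_connected G"
    and "gd_attractor G r T v K"
    and "\<exists>i\<in>verts G. \<exists>x\<in>K i. \<exists>y\<in>K i. x \<noteq> y"
    and "j \<in> verts G"
  shows "\<forall>\<epsilon>>0. \<forall>Q \<in> (top_of_set (carrier orthogonal_group)) closure_of (transformation_group G T j).
    \<exists>\<rho>::real. 0 < \<rho> \<and> \<rho> < 1 \<and>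
      (\<exists>(m::nat) (r'::nat \<Rightarrow> real) (T'::nat \<Rightarrow> real^'d^'d) (v'::nat \<Rightarrow> real^'d) (K'::(real^'d) set).
         ss_ifs m r' T' \<and>
         ss_attractor m r' T' v' K' \<and>
         strong_separation m r' T' v' K' \<and>
         K' \<subseteq> K j \<and>
         hausdorff_dim (K j) - ereal \<epsilon> < hausdorff_dim K' \<and>
         (\<forall>i\<in>{1..m}. onorm ((*v) (T' i - Q)) < \<epsilon> \<and> r' i = \<rho>))"
proof (intro allI impI ballI)
  fix \<epsilon> :: real and Q :: "real^'d^'d"
  assume \<epsilon>: "0 < \<epsilon>"
    and "Q \<in> (top_of_set (carrier orthogonal_group)) closure_of (transformation_group G T j)"
  then have Q: "Q \<in> closure (transformation_group G T j)"
    using closure_mono[of "carrier orthogonal_group \<inter> transformation_group G T j" "transformation_group G T j"]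
    by (auto simp: closure_of_subtopology euclidean_closure_of)
  interpret gd_system G r T v K
    using assms by unfold_locales
  obtain s where s: "hausdorff_dim (K j) = ereal s" "0 \<le> s"
    using dim_finite[OF assms(6)] hausdorff_dim_nonneg[of "K j"] by (cases "hausdorff_dim (K j)") auto
  define t where "t = max 0 (s - \<epsilon> / 2)"
  have t: "0 \<le> t" "t = 0 \<or> ereal t < hausdorff_dim (K j)" "s - \<epsilon> < t"
    using \<epsilon> s by (auto simp: t_def max_def)
  obtain F \<rho> where F: "finite F" "F \<noteq> {}" "\<And>p. p \<in> F \<Longrightarrow> awalk j p j \<and> p \<noteq> [] \<and> ratio p = \<rho>"
    "disjoint_family_on (\<lambda>p. walk_map p ` K j) F" "1 \<le> real (card F) * \<rho> powr t"
    "\<And>p. p \<in> F \<Longrightarrow> norm (walk_matrix T p - Q) < \<epsilon>"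
    using homogeneous_separated_cycles[OF assms(6) Q \<epsilon> t(1,2)] by metis
  obtain m T' v' K' where S: "0 < \<rho>" "\<rho> < 1" "ss_ifs m (\<lambda>_. \<rho>) T'" "ss_attractor m (\<lambda>_. \<rho>) T' v' K'"
    "strong_separation m (\<lambda>_. \<rho>) T' v' K'" "K' \<subseteq> K j" "ereal t \<le> hausdorff_dim K'"
    "\<And>i. i \<in> {1..m} \<Longrightarrow> T' i \<in> walk_matrix T ` F"
    using homogeneous_cycles_ss_ifs[OF assms(6) F(1-5)] by metis
  have "hausdorff_dim (K j) - ereal \<epsilon> < ereal t" using s t by simp
  then have "hausdorff_dim (K j) - ereal \<epsilon> < hausdorff_dim K'" using S(7) by (rule order_less_le_trans)
  moreover have "onorm ((*v) (T' i - Q)) < \<epsilon>" if "i \<in> {1..m}" for i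
    using S(8)[OF that] F(6) onorm_le_norm_matrix[of "T' i - Q"] by force
  ultimately show "\<exists>\<rho>::real. 0 < \<rho> \<and> \<rho> < 1 \<and>
      (\<exists>(m::nat) (r'::nat \<Rightarrow> real) (T'::nat \<Rightarrow> real^'d^'d) (v'::nat \<Rightarrow> real^'d) (K'::(real^'d) set).
         ss_ifs m r' T' \<and> ss_attractor m r' T' v' K' \<and> strong_separation m r' T' v' K' \<and> K' \<subseteq> K j \<and>
         hausdorff_dim (K j) - ereal \<epsilon> < hausdorff_dim K' \<and>
         (\<forall>i\<in>{1..m}. onorm ((*v) (T' i - Q)) < \<epsilon> \<and> r' i = \<rho>))"
    using S(1-6) by (intro exI[of _ \<rho>] conjI exI[of _ m] exI[of _ "\<lambda>_. \<rho>"] exI[of _ T'] exI[of _ v'] exI[of _ K']) auto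
qed

end
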